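(* Let $\Lambda \subset \mathbb{N} \cup \{0\}$ be a finite set. Then, for every real $\alpha \geq -1$ and every real $p > 2$, $$\sup\left\{ \| f \|_{A^p_{\frac{p}{2}(\alpha + 2) - 2}} : \| f \|_{A^2_\alpha} \leq 1 \right\} = \sup \left\{ \| f \|_{A^p_{\frac{p}{2}(\alpha + 2) - 2}} : \| f \|_{A^2_\alpha} \leq 1,\ f^{(j)}(0) = 0 \text{ for all } j \in \Lambda \right\},$$ where $f$ ranges over functions in $A^2_\alpha$.
   Context: Let $\mathbb{D}$ be the open unit disk of $\mathbb{C}$, and let $dA(z) = \frac{1}{\pi}\,dx\,dy$ be the normalized area measure on $\mathbb{D}$. For $q>0$ and $\beta>-1$, the standard weighted Bergman space $A^q_\beta$ is the set of all holomorphic functions $f$ on $\mathbb{D}$ such that $$\|f\|_{A^q_\beta} := \left( (\beta+1)\int_{\mathbb{D}} (1-|z|^2)^\beta |f(z)|^q \, dA(z)\right)^{1/q} < \infty.$$ For $\beta=-1$, by convention $A^q_{-1}$ is the Hardy space $H^q$ of holomorphic $f$ on $\mathbb{D}$ with $$\|f\|_{A^q_{-1}} := \|f\|_{H^q} := \sup_{0<r<1}\left(\frac{1}{2\pi}\int_0^{2\pi}|f(re^{it})|^q\,dt\right)^{1/q}<\infty.$$ Note that $\frac{p}{2}(\alpha+2)-2>-1$ when $p>2$ and $\alpha\ge -1$. *)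

theory Defs
  imports "HOL-Complex_Analysis.Complex_Analysis"
begin

abbreviation unit_disc :: "complex set" where
  "unit_disc \<equiv> ball 0 1"

definition area_measure :: "complex measure" where
  "area_measure = scale_measure (ennreal (1 / pi)) (restrict_space lborel unit_disc)"

text \<open>The power \<open>x\<^sup>a\<close> on \<open>[0, \<infinity>]\<close>; used for \<open>a > 0\<close> only, where \<open>\<infinity>\<^sup>a = \<infinity>\<close>.\<close>

definition ennreal_powr :: "ennreal \<Rightarrow> real \<Rightarrow> ennreal" where
  "ennreal_powr x a = (if x = \<infinity> then \<infinity> else ennreal (enn2real x powr a))"

definition hardy_norm :: "real \<Rightarrow> (complex \<Rightarrow> complex) \<Rightarrow> ennreal" where
  "hardy_norm q f =
     (SUP r\<in>{0<..<1::real}.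
        ennreal_powr
          (ennreal (1 / (2 * pi)) *
             (\<integral>\<^sup>+ t\<in>{0..2 * pi}. ennreal (cmod (f (of_real r * cis t)) powr q) \<partial>lborel))
          (1 / q))"

text \<open>
  The norms take values in \<open>[0, \<infinity>]\<close>: a holomorphic function outside the space has norm \<open>\<infinity>\<close>.
  Parameters are meant to satisfy \<open>q > 0\<close> and \<open>\<beta> \<ge> -1\<close>; the value \<open>\<beta> = -1\<close> is the Hardy space
  by convention.
\<close>

definition bergman_norm :: "real \<Rightarrow> real \<Rightarrow> (complex \<Rightarrow> complex) \<Rightarrow> ennreal" where
  "bergman_norm q \<beta> f =
     (if \<beta> = -1 then hardy_norm q f
      else ennreal_powr
             (ennreal (\<beta> + 1) *
                (\<integral>\<^sup>+ z. ennreal ((1 - (cmod z)\<^sup>2) powr \<beta> * cmod (f z) powr q) \<partial>area_measure))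
             (1 / q))"

text \<open>Elements are total functions on \<open>\<complex>\<close>, of which only the values on the disc matter.\<close>

definition bergman_space :: "real \<Rightarrow> real \<Rightarrow> (complex \<Rightarrow> complex) set" where
  "bergman_space q \<beta> = {f. f holomorphic_on unit_disc \<and> bergman_norm q \<beta> f < \<infinity>}"

end

theory Submission
  imports Defs
begin

text \<open>
  The supremum on the right is taken over fewer functions, so only one inequality needs an argument.
  Both norms are invariant under the weighted translations
  \<open>U\<^sub>a f = f \<circ> \<phi>\<^sub>a \<cdot> (\<phi>\<^sub>a')\<^bsup>(\<alpha>+2)/2\<^esup>\<close> along automorphisms \<open>\<phi>\<^sub>a\<close> of the disc. As \<open>a\<close> tends to the boundary,
  a translate of a fixed \<open>f\<close> is moved away from the origin, and the finitely many Taylor terms with index in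
  \<open>\<Lambda>\<close> can be removed from it at no cost in the limit.

  In detail, let \<open>f\<close> have \<open>A\<^sup>2\<^sub>\<alpha>\<close> norm at most 1, let \<open>P\<^sub>a\<close> be the part of the Taylor series of \<open>U\<^sub>a f\<close>
  with indices in \<open>\<Lambda>\<close>, and let \<open>g\<^sub>a = U\<^sub>a f - P\<^sub>a\<close>. Since \<open>P\<^sub>a\<close> is an orthogonal projection of \<open>U\<^sub>a f\<close>,
  the function \<open>g\<^sub>a\<close> is a competitor on the right, and the coefficients of \<open>P\<^sub>a\<close> are bounded independently
  of \<open>a\<close>. By invariance, \<open>g\<^sub>a\<close> has the same target norm as \<open>U\<^bsub>-a\<^esub> g\<^sub>a = f - U\<^bsub>-a\<^esub> P\<^sub>a\<close>, and
  \<open>U\<^bsub>-a\<^esub> P\<^sub>a\<close> tends to 0 pointwise as \<open>a \<rightarrow> 1\<close>, because the weight of \<open>U\<^bsub>-a\<^esub>\<close> does. Fatou's lemma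
  bounds the target norm of \<open>f\<close> by the supremum on the right; no norm convergence and no finiteness
  of the supremum is involved (lemma \<open>bergman_norm_le_vanishing_bound\<close>).

  Orthogonality is proved on circles, where it is Cauchy's integral formula
  (\<open>circle_energy_pythagoras\<close>), and is carried to the disc by averaging over rotations
  (\<open>bergman_norm_2_mono\<close>). Invariance of the area norms is a change of variables
  (\<open>nn_integral_holomorphic_image\<close>, \<open>nn_integral_disc_translate\<close>). For \<open>\<alpha> = -1\<close> the source space is the
  Hardy space, and only \<open>\<parallel>U\<^sub>a f\<parallel> \<le> \<parallel>f\<parallel>\<close> is needed there: the powers of \<open>\<phi>\<^sub>a\<close> are orthonormal on the
  unit circle for the Poisson kernel of \<open>a\<close>, which settles polynomials, and Fatou's lemma gives the rest
  (\<open>circle_energy_disc_aut_le\<close>).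
\<close>

section \<open>Change of variables under injective holomorphic maps\<close>

definition complex_of_vec :: "real^2 \<Rightarrow> complex" where
  "complex_of_vec v = Complex (v $ 1) (v $ 2)"

definition vec_of_complex :: "complex \<Rightarrow> real^2" where
  "vec_of_complex z = vector [Re z, Im z]"

lemma complex_of_vec_inverse [simp]: "vec_of_complex (complex_of_vec v) = v"
  by (simp add: complex_of_vec_def vec_of_complex_def vec_eq_iff forall_2)

lemma vec_of_complex_inverse [simp]: "complex_of_vec (vec_of_complex z) = z"
  by (simp add: complex_of_vec_def vec_of_complex_def)

lemma bounded_linear_complex_of_vec: "bounded_linear complex_of_vec"
  unfolding linear_conv_bounded_linear [symmetric]
  by (rule linearI) (auto simp: complex_of_vec_def complex_eq_iff)

lemma bounded_linear_vec_of_complex: "bounded_linear vec_of_complex"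
  unfolding linear_conv_bounded_linear [symmetric]
  by (rule linearI) (auto simp: vec_of_complex_def vec_eq_iff forall_2)

lemma continuous_on_complex_of_vec [continuous_intros]:
  "continuous_on A f \<Longrightarrow> continuous_on A (\<lambda>x. complex_of_vec (f x))"
  by (rule bounded_linear.continuous_on [OF bounded_linear_complex_of_vec])

lemma measurable_complex_of_vec [measurable]: "complex_of_vec \<in> borel \<rightarrow>\<^sub>M borel"
  by (intro borel_measurable_continuous_onI continuous_intros)

lemma Basis_vec_2: "(Basis :: (real^2) set) = {axis 1 1, axis 2 1}"
  by (auto simp: Basis_vec_def UNIV_2)

text \<open>
  The change of variables theorem for multiple integrals concerns \<open>real^2\<close>; this identity of measures
  carries it over to \<open>\<complex>\<close>.
\<close>

lemma distr_complex_of_vec: "distr lborel borel complex_of_vec = lborel"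
proof (rule lborel_eqI [symmetric])
  fix l u :: complex
  assume lu: "\<And>b. b \<in> Basis \<Longrightarrow> l \<bullet> b \<le> u \<bullet> b"
  have le: "Re l \<le> Re u" "Im l \<le> Im u"
    using lu[of 1] lu[of \<i>] by (auto simp: Basis_complex_def)
  have pre: "complex_of_vec -` box l u = box (vec_of_complex l) (vec_of_complex u)"
    by (auto simp: box_def Basis_complex_def Basis_vec_2 complex_of_vec_def vec_of_complex_def
        inner_axis)
  have ne: "axis 1 1 \<noteq> (axis 2 1 :: real^2)"
    by (simp add: axis_eq_axis)
  have "emeasure lborel (box (vec_of_complex l) (vec_of_complex u))
      = ennreal ((Re u - Re l) * (Im u - Im l))"
    by (subst emeasure_lborel_box)
       (use le ne in \<open>auto simp: Basis_vec_2 vec_of_complex_def inner_axis\<close>)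
  then show "emeasure (distr lborel borel complex_of_vec) (box l u)
      = ennreal (\<Prod>b\<in>Basis. (u - l) \<bullet> b)"
    by (simp add: emeasure_distr pre Basis_complex_def)
qed simp

text \<open>
  Multiplication by \<open>c = \<phi>'(z)\<close> is the real derivative of \<open>\<phi>\<close> at \<open>z\<close>, so this is its Jacobian.
\<close>

lemma det_complex_mult:
  "det (matrix (\<lambda>v. vec_of_complex (c * complex_of_vec v))) = (cmod c)\<^sup>2"
  unfolding cmod_power2
  by (simp add: det_2 matrix_def complex_of_vec_def vec_of_complex_def axis_def power2_eq_square)

lemma nn_integral_complex_of_vec:
  assumes [measurable]: "f \<in> borel_measurable borel"
  shows "(\<integral>\<^sup>+ z. f z \<partial>lborel) = (\<integral>\<^sup>+ v. f (complex_of_vec v) \<partial>lborel)"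
  by (subst distr_complex_of_vec [symmetric], subst nn_integral_distr) auto

text \<open>
  Preimages of Borel sets are used instead of arbitrary subsets of \<open>S\<close>, so that measurability of the
  image is automatic, and so that the formula says at once that two Borel measures agree.
\<close>

lemma emeasure_holomorphic_image:
  assumes holo: "\<phi> holomorphic_on S" and S: "open S" and inj: "inj_on \<phi> S"
    and B: "B \<in> sets borel"
  shows "emeasure lborel (\<phi> ` S \<inter> B)
       = (\<integral>\<^sup>+ z\<in>S \<inter> \<phi> -` B. ennreal ((cmod (deriv \<phi> z))\<^sup>2) \<partial>lborel)"
proof -
  define A where "A = S \<inter> \<phi> -` B"
  define V where "V = complex_of_vec -` A"
  define G where "G v = vec_of_complex (\<phi> (complex_of_vec v))" for v
  define G' where "G' v = (\<lambda>w. vec_of_complex (deriv \<phi> (complex_of_vec v) * complex_of_vec w))" for v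
  have contS: "continuous_on S \<phi>"
    by (rule holomorphic_on_imp_continuous_on [OF holo])
  have Sb[measurable]: "S \<in> sets borel"
    using S by auto
  have "\<phi> \<in> borel_measurable (restrict_space borel S)"
    by (rule borel_measurable_continuous_on_restrict [OF contS])
  then have "\<phi> -` B \<inter> space (restrict_space borel S) \<in> sets (restrict_space borel S)"
    using B by (rule measurable_sets)
  then have A[measurable]: "A \<in> sets borel"
    by (simp add: A_def space_restrict_space sets_restrict_space_iff Int_commute)
  have openI: "open (\<phi> ` S)"
    by (rule open_mapping_thm3 [OF holo S inj])
  have V[measurable]: "V \<in> sets borel"
    unfolding V_def using measurable_sets[OF measurable_complex_of_vec A] by simp
  have dcont: "continuous_on S (deriv \<phi>)"
    by (rule holomorphic_on_imp_continuous_on [OF holomorphic_deriv [OF holo S]])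
  have dm: "(\<lambda>z. ennreal ((cmod (deriv \<phi> z))\<^sup>2) * indicator A z) \<in> borel_measurable borel"
  proof -
    have "(\<lambda>z. indicator S z *\<^sub>R (cmod (deriv \<phi> z))\<^sup>2) \<in> borel_measurable borel"
      by (rule borel_measurable_continuous_on_indicator) (auto intro!: continuous_intros dcont)
    then have "(\<lambda>z. ennreal (indicator S z *\<^sub>R (cmod (deriv \<phi> z))\<^sup>2) * indicator A z) \<in> borel_measurable borel"
      by measurable
    also have "(\<lambda>z. ennreal (indicator S z *\<^sub>R (cmod (deriv \<phi> z))\<^sup>2) * indicator A z)
       = (\<lambda>z. ennreal ((cmod (deriv \<phi> z))\<^sup>2) * indicator A z)"
      by (auto simp: fun_eq_iff A_def indicator_def)
    finally show ?thesis .
  qed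
  have der: "(G has_derivative G' v) (at v within V)" if "v \<in> V" for v
  proof -
    have "(\<phi> has_field_derivative deriv \<phi> (complex_of_vec v)) (at (complex_of_vec v))"
      using that holo S by (intro holomorphic_derivI) (auto simp: V_def A_def)
    then have d: "(\<phi> has_derivative (\<lambda>w. deriv \<phi> (complex_of_vec v) * w)) (at (complex_of_vec v))"
      by (simp add: has_field_derivative_def)
    have "((\<lambda>v. \<phi> (complex_of_vec v)) has_derivative
        (\<lambda>w. deriv \<phi> (complex_of_vec v) * complex_of_vec w)) (at v within V)"
      by (rule has_derivative_compose
          [OF bounded_linear_imp_has_derivative [OF bounded_linear_complex_of_vec] d])
    then show ?thesis unfolding G_def G'_def
      by (rule bounded_linear.has_derivative [OF bounded_linear_vec_of_complex])
  qed
  have injG: "inj_on G V"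
  proof (rule inj_onI)
    fix v w assume "v \<in> V" "w \<in> V" "G v = G w"
    then have "\<phi> (complex_of_vec v) = \<phi> (complex_of_vec w)"
      unfolding G_def by (metis vec_of_complex_inverse)
    then have "complex_of_vec v = complex_of_vec w"
      using inj \<open>v \<in> V\<close> \<open>w \<in> V\<close> by (auto simp: V_def A_def inj_on_def)
    then show "v = w"
      by (metis complex_of_vec_inverse)
  qed
  have img: "complex_of_vec -` (\<phi> ` S \<inter> B) = G ` V"
  proof (intro equalityI subsetI)
    fix w assume "w \<in> complex_of_vec -` (\<phi> ` S \<inter> B)"
    then obtain z where z: "z \<in> S" "complex_of_vec w = \<phi> z" "\<phi> z \<in> B" by auto
    then have "vec_of_complex z \<in> V" "w = G (vec_of_complex z)"
      by (auto simp: V_def A_def G_def) (metis complex_of_vec_inverse)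
    then show "w \<in> G ` V" by blast
  qed (auto simp: V_def A_def G_def)
  have IB[measurable]: "\<phi> ` S \<inter> B \<in> sets borel"
    using openI B by auto
  have GV: "G ` V \<in> sets borel"
    unfolding img [symmetric] using measurable_sets[OF measurable_complex_of_vec IB] by simp
  have detG: "\<bar>det (matrix (G' v))\<bar> = (cmod (deriv \<phi> (complex_of_vec v)))\<^sup>2" for v
    by (simp add: G'_def det_complex_mult)
  have Vl: "V \<in> sets lebesgue" using V by simp
  define J where "J v = (cmod (deriv \<phi> (complex_of_vec v)))\<^sup>2" for v
  \<comment> \<open>The equivalence also decides the infinite case: if the integral diverges, the image cannot have finite measure.\<close>
  have key: "G ` V \<in> lmeasurable \<and> measure lebesgue (G ` V) = m \<longleftrightarrow> (J has_integral m) V" for m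
    using has_measure_differentiable_image [OF Vl der injG, of m] by (simp add: detG J_def [abs_def])
  have J0: "J v \<ge> 0" for v by (simp add: J_def)
  have "emeasure lborel (\<phi> ` S \<inter> B) = emeasure (distr lborel borel complex_of_vec) (\<phi> ` S \<inter> B)"
    by (simp only: distr_complex_of_vec)
  also have "\<dots> = emeasure lborel (G ` V)"
    by (subst emeasure_distr) (use IB img in \<open>auto\<close>)
  also have "\<dots> = (\<integral>\<^sup>+ v. ennreal (J v * indicator V v) \<partial>lborel)"
  proof (cases "(\<integral>\<^sup>+ v. ennreal (J v * indicator V v) \<partial>lborel) < \<infinity>")
    case True
    have Jm: "(\<lambda>v. J v * indicator V v) \<in> borel_measurable borel"
    proof -
      have "(\<lambda>v. ennreal ((cmod (deriv \<phi> (complex_of_vec v)))\<^sup>2) * indicator A (complex_of_vec v)) \<in> borel_measurable borel"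
        by (rule measurable_compose [OF measurable_complex_of_vec dm])
      then have "(\<lambda>v. enn2real (ennreal ((cmod (deriv \<phi> (complex_of_vec v)))\<^sup>2) * indicator A (complex_of_vec v))) \<in> borel_measurable borel"
        by measurable
      also have "(\<lambda>v. enn2real (ennreal ((cmod (deriv \<phi> (complex_of_vec v)))\<^sup>2) * indicator A (complex_of_vec v))) = (\<lambda>v. J v * indicator V v)"
        by (auto simp: fun_eq_iff J_def V_def indicator_def)
      finally show ?thesis .
    qed
    obtain r where r: "(\<integral>\<^sup>+ v. ennreal (J v * indicator V v) \<partial>lborel) = ennreal r" "r \<ge> 0"
      using True by (cases "\<integral>\<^sup>+ v. ennreal (J v * indicator V v) \<partial>lborel") auto
    have "((\<lambda>v. J v * indicator V v) has_integral r) UNIV"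
      by (rule nn_integral_has_integral) (use Jm r J0 in \<open>auto\<close>)
    also have "(\<lambda>v. J v * indicator V v) = (\<lambda>v. if v \<in> V then J v else 0)"
      by (auto simp: fun_eq_iff)
    finally have "(J has_integral r) V"
      by (simp add: has_integral_restrict_UNIV)
    with key[of r] have "G ` V \<in> lmeasurable" "measure lebesgue (G ` V) = r" by auto
    then have "emeasure lebesgue (G ` V) = r"
      by (metis emeasure_eq_measure2 fmeasurableD2)
    then show ?thesis using r GV by simp
  next
    case False
    have "emeasure lborel (G ` V) = \<infinity>"
    proof (rule ccontr)
      assume fin: "emeasure lborel (G ` V) \<noteq> \<infinity>"
      then have "G ` V \<in> lmeasurable"
        using GV by (auto simp: fmeasurable_def top.not_eq_extremum)
      then have "(J has_integral measure lebesgue (G ` V)) V"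
        using key by blast
      then have "(\<integral>\<^sup>+ v. ennreal (J v) * indicator V v \<partial>lborel) = measure lebesgue (G ` V)"
        by (intro nn_integral_has_integral_lebesgue' J0)
      also have "(\<lambda>v. ennreal (J v) * indicator V v) = (\<lambda>v. ennreal (J v * indicator V v))"
        by (auto simp: fun_eq_iff indicator_def)
      finally show False using False by simp
    qed
    with False show ?thesis by (metis infinity_ennreal_def less_top)
  qed
  also have "\<dots> = (\<integral>\<^sup>+ v. ennreal ((cmod (deriv \<phi> (complex_of_vec v)))\<^sup>2) * indicator A (complex_of_vec v) \<partial>lborel)"
    by (intro nn_integral_cong) (auto simp: J_def V_def indicator_def)
  also have "\<dots> = (\<integral>\<^sup>+ z\<in>A. ennreal ((cmod (deriv \<phi> z))\<^sup>2) \<partial>lborel)"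
    by (rule nn_integral_complex_of_vec [symmetric, OF dm])
  finally show ?thesis
    by (simp add: A_def)
qed

lemma nn_integral_holomorphic_image:
  assumes holo: "\<phi> holomorphic_on S" and S: "open S" and inj: "inj_on \<phi> S"
    and g: "g \<in> borel_measurable borel"
  shows "(\<integral>\<^sup>+ w\<in>\<phi> ` S. g w \<partial>lborel)
       = (\<integral>\<^sup>+ z\<in>S. g (\<phi> z) * ennreal ((cmod (deriv \<phi> z))\<^sup>2) \<partial>lborel)"
proof -
  define d where "d z = ennreal ((cmod (deriv \<phi> z))\<^sup>2)" for z
  let ?R = "restrict_space lborel S"
  have Sb[measurable]: "S \<in> sets borel" and Ib: "\<phi> ` S \<in> sets borel"
    using S open_mapping_thm3 [OF holo S inj] by auto
  have sets_R: "sets ?R = sets (restrict_space borel S)"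
    by (rule sets_restrict_space_cong) simp
  have phi: "\<phi> \<in> borel_measurable ?R"
    using borel_measurable_continuous_on_restrict [OF holomorphic_on_imp_continuous_on [OF holo]]
    by (simp add: measurable_cong_sets [OF sets_R refl])
  have "deriv \<phi> \<in> borel_measurable ?R"
    using borel_measurable_continuous_on_restrict
        [OF holomorphic_on_imp_continuous_on [OF holomorphic_deriv [OF holo S]]]
    by (simp add: measurable_cong_sets [OF sets_R refl])
  then have d: "d \<in> borel_measurable ?R"
    unfolding d_def by measurable
  have eq: "density lborel (indicator (\<phi> ` S)) = distr (density ?R d) borel \<phi>"
  proof (rule measure_eqI)
    fix B assume "B \<in> sets (density lborel (indicator (\<phi> ` S)))"
    then have B: "B \<in> sets borel" by simp
    have pB: "\<phi> -` B \<inter> S \<in> sets ?R"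
      using measurable_sets [OF phi B] by (simp add: space_restrict_space)
    have "emeasure (density lborel (indicator (\<phi> ` S))) B = emeasure lborel (\<phi> ` S \<inter> B)"
      using B Ib by (subst emeasure_density)
        (auto simp flip: indicator_inter_arith)
    also have "\<dots> = (\<integral>\<^sup>+ z\<in>S \<inter> \<phi> -` B. d z \<partial>lborel)"
      unfolding d_def by (rule emeasure_holomorphic_image [OF holo S inj B])
    also have "\<dots> = (\<integral>\<^sup>+ z. d z * indicator (\<phi> -` B \<inter> S) z * indicator S z \<partial>lborel)"
      by (intro nn_integral_cong) (auto simp: indicator_def)
    also have "\<dots> = (\<integral>\<^sup>+ z. d z * indicator (\<phi> -` B \<inter> S) z \<partial>?R)"
      by (subst nn_integral_restrict_space) auto
    also have "\<dots> = emeasure (density ?R d) (\<phi> -` B \<inter> S)"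
      by (rule emeasure_density [OF d pB, symmetric])
    also have "\<dots> = emeasure (distr (density ?R d) borel \<phi>) B"
      using phi B by (subst emeasure_distr) (auto simp: space_restrict_space)
    finally show "emeasure (density lborel (indicator (\<phi> ` S))) B = emeasure (distr (density ?R d) borel \<phi>) B" .
  qed simp
  have "(\<integral>\<^sup>+ w\<in>\<phi> ` S. g w \<partial>lborel) = (\<integral>\<^sup>+ w. g w \<partial>density lborel (indicator (\<phi> ` S)))"
    using Ib g by (subst nn_integral_density) (auto simp: mult.commute)
  also have "\<dots> = (\<integral>\<^sup>+ z. g (\<phi> z) \<partial>density ?R d)"
    unfolding eq using phi g by (subst nn_integral_distr) auto
  also have "\<dots> = (\<integral>\<^sup>+ z. d z * g (\<phi> z) \<partial>?R)"
    by (rule nn_integral_density [OF d measurable_compose [OF phi g]])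
  also have "\<dots> = (\<integral>\<^sup>+ z\<in>S. g (\<phi> z) * d z \<partial>lborel)"
    by (subst nn_integral_restrict_space) (auto simp: mult.commute)
  finally show ?thesis by (simp add: d_def)
qed

section \<open>Powers of extended nonnegative reals\<close>

text \<open>
  This Galois connection replaces any continuity argument for roots of suprema and of limits.
\<close>

lemma ennreal_powr_le_iff:
  assumes "a > 0"
  shows "ennreal_powr x a \<le> B \<longleftrightarrow> x \<le> ennreal_powr B (1 / a)"
proof (cases x; cases B)
  fix r s :: real assume rs: "x = ennreal r" "0 \<le> r" "B = ennreal s" "0 \<le> s"
  have "r powr a \<le> s \<longleftrightarrow> r \<le> s powr (1 / a)"
  proof
    assume "r powr a \<le> s"
    then have "(r powr a) powr (1 / a) \<le> s powr (1 / a)"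
      using assms by (intro powr_mono2) auto
    then show "r \<le> s powr (1 / a)" using assms rs by (simp add: powr_powr)
  next
    assume "r \<le> s powr (1 / a)"
    then have "r powr a \<le> (s powr (1 / a)) powr a"
      using assms rs by (intro powr_mono2) auto
    then show "r powr a \<le> s" using assms rs by (simp add: powr_powr)
  qed
  then show ?thesis using rs by (simp add: ennreal_powr_def)
qed (auto simp: ennreal_powr_def top_unique)

lemma ennreal_powr_mono: "a > 0 \<Longrightarrow> x \<le> y \<Longrightarrow> ennreal_powr x a \<le> ennreal_powr y a"
  using ennreal_powr_le_iff [of a x "ennreal_powr y a"] ennreal_powr_le_iff [of a y "ennreal_powr y a"]
  by (simp add: order_trans)

lemma ennreal_powr_le_1_iff: "a > 0 \<Longrightarrow> ennreal_powr x a \<le> 1 \<longleftrightarrow> x \<le> 1"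
  by (simp add: ennreal_powr_le_iff) (simp add: ennreal_powr_def)

section \<open>Square means over circles\<close>

text \<open>
  The circle is parametrised from an arbitrary complex base point \<open>z\<close>, not from a radius: averaging over
  rotations of the disc then produces \<open>circle_energy F z\<close> without any polar coordinates.
\<close>

definition circle_energy :: "(complex \<Rightarrow> complex) \<Rightarrow> complex \<Rightarrow> ennreal" where
  "circle_energy F z = (\<integral>\<^sup>+ t\<in>{0..2 * pi}. ennreal ((cmod (F (z * cis t)))\<^sup>2) \<partial>lborel)"

lemma circle_energy_eq:
  assumes "continuous_on {0..2 * pi} (\<lambda>t. F (z * cis t))"
  shows "circle_energy F z = ennreal (integral {0..2 * pi} (\<lambda>t. (cmod (F (z * cis t)))\<^sup>2))"
  unfolding circle_energy_def
  by (rule nn_integral_has_integral_lebesgue')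
     (auto intro!: integrable_integral integrable_continuous_real continuous_intros assms)

lemma hardy_norm_2_le_1_iff:
  "hardy_norm 2 f \<le> 1 \<longleftrightarrow> (\<forall>r\<in>{0<..<1}. circle_energy f (of_real r) \<le> ennreal (2 * pi))"
proof -
  have "ennreal (1 / (2 * pi)) * x \<le> 1 \<longleftrightarrow> x \<le> ennreal (2 * pi)" for x
  proof (cases x)
    case (real r)
    then have "ennreal (1 / (2 * pi)) * x = ennreal (r / (2 * pi))"
      by (simp flip: ennreal_mult)
    then show ?thesis
      using real by (simp add: ennreal_le_1 field_simps)
  next
    case top
    then show ?thesis by (simp add: ennreal_mult_top top_unique)
  qed
  then show ?thesis
    unfolding hardy_norm_def SUP_le_iff circle_energy_def by (simp add: ennreal_powr_le_1_iff)
qed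

lemma hardy_norm_2_mono:
  assumes "\<And>r. r \<in> {0<..<1} \<Longrightarrow> circle_energy f (of_real r) \<le> circle_energy g (of_real r)"
  shows "hardy_norm 2 f \<le> hardy_norm 2 g"
  unfolding hardy_norm_def
proof (rule SUP_mono, rule bexI)
  fix r :: real assume r: "r \<in> {0<..<1}"
  then show "ennreal_powr (ennreal (1 / (2 * pi)) * (\<integral>\<^sup>+ t\<in>{0..2 * pi}. ennreal (cmod (f (of_real r * cis t)) powr 2) \<partial>lborel)) (1 / 2)
    \<le> ennreal_powr (ennreal (1 / (2 * pi)) * (\<integral>\<^sup>+ t\<in>{0..2 * pi}. ennreal (cmod (g (of_real r * cis t)) powr 2) \<partial>lborel)) (1 / 2)"
    using assms[OF r] unfolding circle_energy_def
    by (intro ennreal_powr_mono mult_left_mono) auto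
qed

section \<open>Orthogonality of Taylor parts on circles\<close>

definition taylor_part :: "nat set \<Rightarrow> (complex \<Rightarrow> complex) \<Rightarrow> complex \<Rightarrow> complex" where
  "taylor_part S f z = (\<Sum>k\<in>S. (deriv ^^ k) f 0 / fact k * z ^ k)"

lemma holomorphic_on_taylor_part [holomorphic_intros]: "taylor_part S f holomorphic_on A"
  unfolding taylor_part_def by (intro holomorphic_intros) auto

lemma deriv_minus_taylor_part:
  assumes f: "f holomorphic_on ball 0 R" and R: "R > 0" and S: "finite S" and k: "k \<in> S"
  shows "(deriv ^^ k) (\<lambda>z. f z - taylor_part S f z) 0 = 0"
proof -
  define c where "c k = (deriv ^^ k) f 0 / fact k" for k
  have F: "f has_fps_expansion fps_expansion f 0"
    by (rule has_fps_expansion_fps_expansion [of "ball 0 R"]) (use f R in auto)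
  have "(\<lambda>z. f z - taylor_part S f z) has_fps_expansion
      (fps_expansion f 0 - (\<Sum>k\<in>S. fps_const (c k) * fps_X ^ k))"
    unfolding taylor_part_def c_def by (intro fps_expansion_intros F)
  from fps_nth_fps_expansion [OF this, of k]
  have "(deriv ^^ k) (\<lambda>z. f z - taylor_part S f z) 0 / fact k
     = fps_nth (fps_expansion f 0) k - (\<Sum>j\<in>S. if k = j then c j else 0)"
    by (simp add: fps_sum_nth if_distrib cong: if_cong)
  also have "\<dots> = 0"
    using S k fps_nth_fps_expansion [OF F, of k] by (simp add: sum.delta c_def)
  finally show ?thesis by simp
qed

text \<open>
  Cauchy's integral formula for \<open>u \<mapsto> F (z * u)\<close> on the unit circle.
\<close>

lemma fourier_coefficient_circle:
  fixes F :: "complex \<Rightarrow> complex" and z :: complex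
  assumes F: "F holomorphic_on ball 0 R" and z: "cmod z < R"
  shows "((\<lambda>t. F (z * cis t) * cnj (cis t) ^ k) has_integral
            (2 * pi * z ^ k * (deriv ^^ k) F 0 / fact k)) {0..2 * pi}"
proof -
  define A where "A = (\<lambda>u. z * u) -` ball 0 R"
  have A: "open A"
    unfolding A_def by (intro open_vimage continuous_intros) auto
  have sub: "cball 0 1 \<subseteq> A"
  proof
    fix u :: complex assume "u \<in> cball 0 1"
    then have "cmod z * cmod u \<le> cmod z * 1" by (intro mult_left_mono) auto
    then show "u \<in> A" using z by (simp add: A_def norm_mult)
  qed
  have holo: "(\<lambda>u. F (z * u)) holomorphic_on A"
    using holomorphic_on_compose_gen [of "\<lambda>u. z * u" A F "ball 0 R"] F
    by (auto simp: A_def o_def intro!: holomorphic_intros)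
  have d: "(deriv ^^ k) (\<lambda>u. F (z * u)) 0 = z ^ k * (deriv ^^ k) F (z * 0)"
    by (rule higher_deriv_compose_linear [OF F A]) (use sub z in \<open>auto simp: A_def intro: le_less_trans [OF norm_ge_zero]\<close>)
  have sub': "ball 0 1 \<subseteq> A" using sub ball_subset_cball by blast
  have "((\<lambda>u. F (z * u) / (u - 0) ^ Suc k) has_contour_integral
      ((2 * pi * \<i>) / fact k * (deriv ^^ k) (\<lambda>u. F (z * u)) 0)) (circlepath 0 1)"
    by (rule Cauchy_has_contour_integral_higher_derivative_circlepath)
       (use holo sub sub' in \<open>auto intro: holomorphic_on_subset holomorphic_on_imp_continuous_on\<close>)
  then have "((\<lambda>t. F (z * cis t) / cis t ^ Suc k * \<i> * cis t) has_integral
      (2 * pi * \<i> / fact k * (z ^ k * (deriv ^^ k) F 0))) {0..2 * pi}"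
    unfolding circlepath_def d by (subst (asm) has_contour_integral_part_circlepath_iff) auto
  then have "((\<lambda>t. - \<i> * (F (z * cis t) / cis t ^ Suc k * \<i> * cis t)) has_integral
      (- \<i> * (2 * pi * \<i> / fact k * (z ^ k * (deriv ^^ k) F 0)))) {0..2 * pi}"
    by (rule has_integral_mult_right)
  moreover have "- \<i> * (F (z * cis t) / cis t ^ Suc k * \<i> * cis t) = F (z * cis t) * cnj (cis t) ^ k" for t
  proof -
    have "cnj (cis t) ^ k = 1 / cis t ^ k"
      by (simp add: cis_cnj divide_inverse flip: power_inverse)
    then show ?thesis by (simp add: field_simps)
  qed
  ultimately show ?thesis
    by (simp add: mult_ac)
qed

lemma continuous_on_circle:
  assumes "continuous_on (ball 0 R) F" "cmod z < R"
  shows "continuous_on X (\<lambda>t. F (z * cis t))"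
  by (rule continuous_on_compose2 [OF assms(1)])
     (use assms(2) in \<open>auto intro!: continuous_intros simp: norm_mult\<close>)

text \<open>
  On a circle, \<open>f\<close> minus its Taylor terms with indices in \<open>S\<close> has vanishing Fourier coefficients
  at every index in \<open>S\<close>, hence is orthogonal to those terms.
\<close>

lemma circle_energy_pythagoras:
  assumes f: "f holomorphic_on ball 0 R" and z: "cmod z < R" and S: "finite S"
  shows "circle_energy f z
       = circle_energy (\<lambda>z. f z - taylor_part S f z) z + circle_energy (taylor_part S f) z"
proof -
  define T where "T = taylor_part S f"
  define h where "h z = f z - T z" for z
  have R: "R > 0" using z norm_ge_zero order_le_less_trans by blast
  have T: "T holomorphic_on ball 0 R" unfolding T_def by (rule holomorphic_on_taylor_part)
  have h: "h holomorphic_on ball 0 R" unfolding h_def by (intro holomorphic_intros f T)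
  note cont = continuous_on_circle [OF holomorphic_on_imp_continuous_on z]
  have h0: "((\<lambda>t. h (z * cis t) * cnj (cis t) ^ k) has_integral 0) {0..2 * pi}" if "k \<in> S" for k
    using fourier_coefficient_circle [OF h z, of k] deriv_minus_taylor_part [OF f R S that]
    by (simp add: h_def [abs_def] T_def)
  define d where "d k = cnj ((deriv ^^ k) f 0 / fact k * z ^ k)" for k
  have "((\<lambda>t. \<Sum>k\<in>S. d k * (h (z * cis t) * cnj (cis t) ^ k)) has_integral (\<Sum>k\<in>S. d k * 0)) {0..2 * pi}"
    by (intro has_integral_sum S has_integral_mult_right h0)
  moreover have "(\<Sum>k\<in>S. d k * (h (z * cis t) * cnj (cis t) ^ k)) = h (z * cis t) * cnj (T (z * cis t))" for t
    by (simp add: T_def taylor_part_def d_def sum_distrib_left power_mult_distrib mult_ac)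
  ultimately have "((\<lambda>t. h (z * cis t) * cnj (T (z * cis t))) has_integral 0) {0..2 * pi}"
    by simp
  from has_integral_linear [OF this bounded_linear_Re]
  have cross: "((\<lambda>t. 2 * Re (h (z * cis t) * cnj (T (z * cis t)))) has_integral 2 * 0) {0..2 * pi}"
    by (intro has_integral_mult_right) (simp add: o_def)
  have int: "((\<lambda>t. (cmod (F (z * cis t)))\<^sup>2) has_integral integral {0..2 * pi} (\<lambda>t. (cmod (F (z * cis t)))\<^sup>2)) {0..2 * pi}"
    if "F holomorphic_on ball 0 R" for F
    by (intro integrable_integral integrable_continuous_real continuous_intros cont that)
  have sq: "(cmod (h w))\<^sup>2 + (cmod (T w))\<^sup>2 + 2 * Re (h w * cnj (T w)) = (cmod (f w))\<^sup>2" for w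
    unfolding h_def cmod_power2 by (simp add: power2_eq_square algebra_simps)
  have "((\<lambda>t. (cmod (f (z * cis t)))\<^sup>2) has_integral
      (integral {0..2 * pi} (\<lambda>t. (cmod (h (z * cis t)))\<^sup>2) + integral {0..2 * pi} (\<lambda>t. (cmod (T (z * cis t)))\<^sup>2) + 2 * 0)) {0..2 * pi}"
    unfolding sq [symmetric] by (intro has_integral_add cross int h T)
  then have "integral {0..2 * pi} (\<lambda>t. (cmod (f (z * cis t)))\<^sup>2) =
      integral {0..2 * pi} (\<lambda>t. (cmod (h (z * cis t)))\<^sup>2) + integral {0..2 * pi} (\<lambda>t. (cmod (T (z * cis t)))\<^sup>2)"
    by (simp add: integral_unique)
  moreover have "circle_energy F z = ennreal (integral {0..2 * pi} (\<lambda>t. (cmod (F (z * cis t)))\<^sup>2))"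
    if "F holomorphic_on ball 0 R" for F
    by (rule circle_energy_eq [OF cont [OF that]])
  moreover have "integral {0..2 * pi} (\<lambda>t. (cmod (F t))\<^sup>2) \<ge> 0" for F :: "real \<Rightarrow> complex"
    by (cases "(\<lambda>t. (cmod (F t))\<^sup>2) integrable_on {0..2 * pi}")
       (auto intro: integral_nonneg simp: not_integrable_integral)
  ultimately have "circle_energy f z = circle_energy h z + circle_energy T z"
    using f h T by (simp add: ennreal_plus)
  then show ?thesis by (simp add: h_def [abs_def] T_def)
qed

corollary circle_energy_taylor_part_le:
  assumes "f holomorphic_on ball 0 R" "cmod z < R" "finite S"
  shows "circle_energy (taylor_part S f) z \<le> circle_energy f z"
    and "circle_energy (\<lambda>z. f z - taylor_part S f z) z \<le> circle_energy f z"
  using circle_energy_pythagoras [OF assms] by (simp_all add: add_increasing add_increasing2)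

section \<open>From circles to the disc\<close>

lemma nn_integral_rotate:
  assumes "g \<in> borel_measurable borel"
  shows "(\<integral>\<^sup>+ z. g (z * cis t) \<partial>lborel) = (\<integral>\<^sup>+ z. g z \<partial>lborel)"
proof -
  have inj: "inj_on (\<lambda>z. z * cis t) UNIV" by (auto simp: inj_on_def)
  have "range (\<lambda>z. z * cis t) = UNIV"
    by (auto intro!: image_eqI [of _ _ "_ / cis t"])
  moreover have "deriv (\<lambda>z. z * cis t) = (\<lambda>z. cis t)"
    by (intro ext DERIV_imp_deriv) (auto intro!: derivative_eq_intros)
  moreover have "(\<lambda>z. z * cis t) holomorphic_on UNIV"
    by (intro holomorphic_intros)
  ultimately show ?thesis
    using nn_integral_holomorphic_image [of "\<lambda>z. z * cis t" UNIV g] assms inj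
    by simp
qed

text \<open>
  A radial weight does not see rotations, so the integrand may be replaced by its average over all
  rotations; Tonelli's theorem turns that average into a circle integral.
\<close>

lemma nn_integral_disc_eq_circle_energy:
  fixes W :: "real \<Rightarrow> ennreal"
  assumes F: "continuous_on unit_disc F" and W[measurable]: "W \<in> borel_measurable borel"
  shows "ennreal (2 * pi) * (\<integral>\<^sup>+ z\<in>unit_disc. W (cmod z) * ennreal ((cmod (F z))\<^sup>2) \<partial>lborel)
       = (\<integral>\<^sup>+ z\<in>unit_disc. W (cmod z) * circle_energy F z \<partial>lborel)"
proof -
  have "(\<lambda>z. indicator unit_disc z *\<^sub>R F z) \<in> borel_measurable borel"
    by (rule borel_measurable_continuous_on_indicator) (auto simp: F)
  then have [measurable]: "(\<lambda>z. ennreal ((cmod (indicator unit_disc z *\<^sub>R F z))\<^sup>2)) \<in> borel_measurable borel"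
    by measurable
  define K where "K z = W (cmod z) * ennreal ((cmod (indicator unit_disc z *\<^sub>R F z))\<^sup>2)" for z
  have K[measurable]: "K \<in> borel_measurable borel" unfolding K_def by measurable
  have [measurable]: "cis \<in> borel_measurable borel"
    by (intro borel_measurable_continuous_onI continuous_intros)
  have "ennreal (2 * pi) * (\<integral>\<^sup>+ z\<in>unit_disc. W (cmod z) * ennreal ((cmod (F z))\<^sup>2) \<partial>lborel)
      = (\<integral>\<^sup>+ t\<in>{0..2 * pi}. (\<integral>\<^sup>+ z. K z \<partial>lborel) \<partial>lborel)"
  proof -
    have "(\<integral>\<^sup>+ z\<in>unit_disc. W (cmod z) * ennreal ((cmod (F z))\<^sup>2) \<partial>lborel) = (\<integral>\<^sup>+ z. K z \<partial>lborel)"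
      by (intro nn_integral_cong) (auto simp: K_def indicator_def)
    then show ?thesis
      by (simp add: nn_integral_cmult_indicator mult.commute)
  qed
  also have "\<dots> = (\<integral>\<^sup>+ t. (\<integral>\<^sup>+ z. K (z * cis t) * indicator {0..2 * pi} t \<partial>lborel) \<partial>lborel)"
    by (simp add: nn_integral_multc nn_integral_rotate)
  also have "\<dots> = (\<integral>\<^sup>+ z. (\<integral>\<^sup>+ t. K (z * cis t) * indicator {0..2 * pi} t \<partial>lborel) \<partial>lborel)"
    by (rule lborel_pair.Fubini' [symmetric]) measurable
  also have "\<dots> = (\<integral>\<^sup>+ z\<in>unit_disc. W (cmod z) * circle_energy F z \<partial>lborel)"
  proof (rule nn_integral_cong)
    fix z :: complex
    show "(\<integral>\<^sup>+ t. K (z * cis t) * indicator {0..2 * pi} t \<partial>lborel) =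
        W (cmod z) * circle_energy F z * indicator unit_disc z"
    proof (cases "z \<in> unit_disc")
      case True
      have "continuous_on UNIV (\<lambda>t. F (z * cis t))"
        by (rule continuous_on_circle [OF F]) (use True in auto)
      then have [measurable]: "(\<lambda>t. F (z * cis t)) \<in> borel_measurable borel"
        by (rule borel_measurable_continuous_onI)
      show ?thesis using True
        by (simp add: circle_energy_def K_def norm_mult mult.assoc nn_integral_cmult)
    qed (simp add: K_def norm_mult)
  qed
  finally show ?thesis .
qed

lemma bergman_norm_area:
  assumes f: "continuous_on unit_disc f" and \<beta>: "\<beta> \<noteq> -1"
  shows "bergman_norm q \<beta> f = ennreal_powr (ennreal (\<beta> + 1) * (ennreal (1 / pi) *
     (\<integral>\<^sup>+ z\<in>unit_disc. ennreal ((1 - (cmod z)\<^sup>2) powr \<beta> * cmod (f z) powr q) \<partial>lborel))) (1 / q)"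
proof -
  have "f \<in> borel_measurable (restrict_space borel unit_disc)"
    by (rule borel_measurable_continuous_on_restrict [OF f])
  then have [measurable]: "f \<in> borel_measurable (restrict_space lborel unit_disc)"
    by (simp add: measurable_cong_sets [OF sets_restrict_space_cong [of lborel borel] refl])
  have [measurable]: "(\<lambda>z. cmod z) \<in> borel_measurable (restrict_space lborel unit_disc)"
    by (rule measurable_restrict_space1) simp
  show ?thesis
    unfolding bergman_norm_def area_measure_def using \<beta>
    by (simp add: nn_integral_scale_measure nn_integral_restrict_space)
qed

text \<open>
  Inequalities on all circles pass to every norm \<open>A\<^sup>2\<^sub>\<alpha>\<close>, the Hardy norm included. This is how removing
  Taylor terms is seen to decrease these norms, with no use of their expression by coefficients.
\<close>

lemma bergman_norm_2_mono:
  assumes F: "continuous_on unit_disc F" and G: "continuous_on unit_disc G"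
    and le: "\<And>z. z \<in> unit_disc \<Longrightarrow> circle_energy F z \<le> circle_energy G z"
  shows "bergman_norm 2 \<alpha> F \<le> bergman_norm 2 \<alpha> G"
proof (cases "\<alpha> = -1")
  case True
  then show ?thesis using le by (auto simp: bergman_norm_def intro!: hardy_norm_2_mono)
next
  case False
  let ?W = "\<lambda>x. ennreal ((1 - x\<^sup>2) powr \<alpha>)"
  have "ennreal (2 * pi) * (\<integral>\<^sup>+ z\<in>unit_disc. ?W (cmod z) * ennreal ((cmod (F z))\<^sup>2) \<partial>lborel)
     \<le> ennreal (2 * pi) * (\<integral>\<^sup>+ z\<in>unit_disc. ?W (cmod z) * ennreal ((cmod (G z))\<^sup>2) \<partial>lborel)"
    using le F G
    by (subst (1 2) nn_integral_disc_eq_circle_energy)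
       (auto intro!: nn_integral_mono mult_left_mono simp: indicator_def)
  then have "(\<integral>\<^sup>+ z\<in>unit_disc. ?W (cmod z) * ennreal ((cmod (F z))\<^sup>2) \<partial>lborel)
     \<le> (\<integral>\<^sup>+ z\<in>unit_disc. ?W (cmod z) * ennreal ((cmod (G z))\<^sup>2) \<partial>lborel)"
    by (simp add: ennreal_mult_le_mult_iff)
  then show ?thesis
    using False F G
    by (auto simp: bergman_norm_area ennreal_mult intro!: ennreal_powr_mono mult_left_mono)
qed

text \<open>
  A single Taylor term has norm at most that of the function, and the norm of a monomial is not zero.
\<close>

lemma taylor_coefficient_bounded:
  assumes \<alpha>: "\<alpha> \<ge> -1"
  shows "\<exists>K. \<forall>f. f holomorphic_on unit_disc \<longrightarrow> bergman_norm 2 \<alpha> f \<le> 1 \<longrightarrow>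
      cmod ((deriv ^^ k) f 0 / fact k) \<le> K"
proof -
  have mono: "bergman_norm 2 \<alpha> (\<lambda>z. (deriv ^^ k) f 0 / fact k * z ^ k) \<le> 1"
    if f: "f holomorphic_on unit_disc" "bergman_norm 2 \<alpha> f \<le> 1" for f
  proof -
    have "bergman_norm 2 \<alpha> (taylor_part {k} f) \<le> bergman_norm 2 \<alpha> f"
      by (intro bergman_norm_2_mono circle_energy_taylor_part_le(1) [of _ 1]
            holomorphic_on_imp_continuous_on holomorphic_intros f) auto
    then show ?thesis using f(2) by (simp add: taylor_part_def [abs_def])
  qed
  have "\<exists>m>0. \<forall>c. bergman_norm 2 \<alpha> (\<lambda>z. c * z ^ k) \<le> 1 \<longrightarrow> ennreal ((cmod c)\<^sup>2) * m \<le> 1"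
  proof (cases "\<alpha> = -1")
    case True
    show ?thesis
    proof (intro exI [of _ "ennreal (((1 / 2) ^ k)\<^sup>2)"] conjI allI impI)
      fix c :: complex
      assume "bergman_norm 2 \<alpha> (\<lambda>z. c * z ^ k) \<le> 1"
      then have "circle_energy (\<lambda>z. c * z ^ k) (of_real (1 / 2)) \<le> ennreal (2 * pi)"
        using True by (auto simp: bergman_norm_def hardy_norm_2_le_1_iff dest!: bspec [of _ _ "1 / 2"])
      also have "circle_energy (\<lambda>z. c * z ^ k) (of_real (1 / 2)) = ennreal (2 * pi * ((cmod c)\<^sup>2 * ((1 / 2) ^ k)\<^sup>2))"
        by (subst circle_energy_eq)
           (auto intro!: continuous_intros simp: norm_mult norm_power norm_divide power_mult_distrib power_divide)
      finally have "(cmod c)\<^sup>2 * ((1 / 2) ^ k)\<^sup>2 \<le> 1" by simp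
      then show "ennreal ((cmod c)\<^sup>2) * ennreal (((1 / 2) ^ k)\<^sup>2) \<le> 1"
        by (simp add: ennreal_le_1 flip: ennreal_mult)
    qed simp
  next
    case False
    define I where "I = (\<integral>\<^sup>+ z\<in>unit_disc. ennreal ((1 - (cmod z)\<^sup>2) powr \<alpha> * cmod (z ^ k) powr 2) \<partial>lborel)"
    have M: "(\<lambda>z::complex. ennreal ((1 - (cmod z)\<^sup>2) powr \<alpha> * cmod (z ^ k) powr 2) * indicator unit_disc z)
        \<in> borel_measurable lborel"
      by (intro borel_measurable_times_ennreal borel_measurable_indicator) simp_all
    have "I \<noteq> 0"
    proof
      assume "I = 0"
      then have "AE z in lborel. ennreal ((1 - (cmod z)\<^sup>2) powr \<alpha> * cmod (z ^ k) powr 2) * indicator unit_disc z = 0"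
        unfolding I_def by (rule nn_integral_0_iff_AE [OF M, THEN iffD1])
      then have "AE z in lborel. z \<notin> unit_disc - {0::complex}"
      proof eventually_elim
        case (elim z)
        show ?case
        proof
          assume z: "z \<in> unit_disc - {0}"
          then have "(cmod z)\<^sup>2 < 1" by (simp add: power_less_one_iff abs_square_less_1)
          then show False using elim z by (auto simp: not_less)
        qed
      qed
      then have "unit_disc - {0::complex} \<in> null_sets lborel"
        by (subst AE_iff_null_sets) (auto simp: )
      then have "negligible (unit_disc - {0::complex})"
        by (simp add: negligible_iff_null_sets null_sets_completionI)
      moreover have "open (unit_disc - {0::complex})" "(1/2::complex) \<in> unit_disc - {0}" by auto
      ultimately show False using open_not_negligible by blast
    qed
    show ?thesis
    proof (intro exI [of _ "ennreal (\<alpha> + 1) * (ennreal (1 / pi) * I)"] conjI allI impI)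
      show "0 < ennreal (\<alpha> + 1) * (ennreal (1 / pi) * I)"
        using \<open>I \<noteq> 0\<close> False \<alpha> by (simp add: ennreal_zero_less_mult_iff zero_less_iff_neq_zero)
      fix c :: complex
      assume "bergman_norm 2 \<alpha> (\<lambda>z. c * z ^ k) \<le> 1"
      then have "ennreal (\<alpha> + 1) * (ennreal (1 / pi) *
          (\<integral>\<^sup>+ z\<in>unit_disc. ennreal ((1 - (cmod z)\<^sup>2) powr \<alpha> * cmod (c * z ^ k) powr 2) \<partial>lborel)) \<le> 1"
        using False by (subst (asm) bergman_norm_area) (auto intro!: continuous_intros simp: ennreal_powr_le_1_iff)
      also have "(\<integral>\<^sup>+ z\<in>unit_disc. ennreal ((1 - (cmod z)\<^sup>2) powr \<alpha> * cmod (c * z ^ k) powr 2) \<partial>lborel)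
          = (\<integral>\<^sup>+ z. ennreal ((cmod c)\<^sup>2) * (ennreal ((1 - (cmod z)\<^sup>2) powr \<alpha> * cmod (z ^ k) powr 2) * indicator unit_disc z) \<partial>lborel)"
        by (intro nn_integral_cong)
           (auto simp: norm_mult power_mult_distrib indicator_def mult_ac ennreal_mult [symmetric])
      also have "\<dots> = ennreal ((cmod c)\<^sup>2) * I"
        unfolding I_def by (rule nn_integral_cmult [OF M])
      finally show "ennreal ((cmod c)\<^sup>2) * (ennreal (\<alpha> + 1) * (ennreal (1 / pi) * I)) \<le> 1"
        by (simp add: mult_ac)
    qed
  qed
  then obtain m where m: "m > 0"
    "\<And>c. bergman_norm 2 \<alpha> (\<lambda>z. c * z ^ k) \<le> 1 \<Longrightarrow> ennreal ((cmod c)\<^sup>2) * m \<le> 1" by blast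
  obtain \<mu> :: real where \<mu>: "\<mu> > 0" "ennreal \<mu> \<le> m"
  proof (cases m)
    case (real r)
    then show ?thesis using m(1) that [of r] by simp
  next
    case top
    then show ?thesis using that [of 1] by simp
  qed
  show ?thesis
  proof (intro exI allI impI)
    fix f :: "complex \<Rightarrow> complex"
    assume f: "f holomorphic_on unit_disc" "bergman_norm 2 \<alpha> f \<le> 1"
    define c where "c = (deriv ^^ k) f 0 / fact k"
    have "ennreal ((cmod c)\<^sup>2) * ennreal \<mu> \<le> ennreal ((cmod c)\<^sup>2) * m"
      by (intro mult_left_mono \<mu>) auto
    also have "\<dots> \<le> 1" using m(2) [OF mono [OF f]] by (simp add: c_def)
    finally have "(cmod c)\<^sup>2 * \<mu> \<le> 1" using \<mu> by (simp add: ennreal_le_1 flip: ennreal_mult)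
    then have "(cmod c)\<^sup>2 \<le> 1 / \<mu>" using \<mu> by (simp add: field_simps)
    then show "cmod ((deriv ^^ k) f 0 / fact k) \<le> sqrt (1 / \<mu>)"
      unfolding c_def [symmetric] by (rule real_le_rsqrt)
  qed
qed

section \<open>Disc automorphisms\<close>

text \<open>
  The parameter is real because it need only tend to \<open>1\<close>; its negative gives the inverse map.
\<close>

definition disc_aut :: "real \<Rightarrow> complex \<Rightarrow> complex" where
  "disc_aut a z = (z - of_real a) / (1 - of_real a * z)"

text \<open>
  A holomorphic square root of the derivative of the automorphism. Its modulus to the powers 2 and 4 is the
  factor by which \<open>1 - \<bar>z\<bar>\<^sup>2\<close> and areas change.
\<close>

definition disc_aut_factor :: "real \<Rightarrow> complex \<Rightarrow> complex" where
  "disc_aut_factor a z = of_real (sqrt (1 - a\<^sup>2)) / (1 - of_real a * z)"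

lemma disc_aut_denominator_nonzero:
  assumes "\<bar>a\<bar> < 1" "cmod z \<le> 1"
  shows "1 - of_real a * z \<noteq> 0"
proof
  assume "1 - of_real a * z = 0"
  then have "of_real a * z = 1" by simp
  then have "cmod (of_real a * z) = 1" by simp
  then have "\<bar>a\<bar> * cmod z = 1" by (simp add: norm_mult)
  moreover have "\<bar>a\<bar> * cmod z \<le> \<bar>a\<bar> * 1"
    using assms by (intro mult_left_mono) auto
  ultimately show False using assms by simp
qed

lemma cmod_disc_aut_factor_power2:
  assumes "\<bar>a\<bar> < 1"
  shows "(cmod (disc_aut_factor a z))\<^sup>2 = (1 - a\<^sup>2) / (cmod (1 - of_real a * z))\<^sup>2"
proof -
  have "a\<^sup>2 < 1" using assms by (simp add: abs_square_less_1)
  then show ?thesis by (simp add: disc_aut_factor_def norm_divide power_divide)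
qed

lemma one_minus_cmod_disc_aut:
  assumes a: "\<bar>a\<bar> < 1" and z: "cmod z \<le> 1"
  shows "1 - (cmod (disc_aut a z))\<^sup>2 = (1 - (cmod z)\<^sup>2) * (cmod (disc_aut_factor a z))\<^sup>2"
proof -
  have "(cmod (1 - of_real a * z))\<^sup>2 - (cmod (z - of_real a))\<^sup>2 = (1 - (cmod z)\<^sup>2) * (1 - a\<^sup>2)"
    unfolding cmod_power2 by (simp add: power2_eq_square algebra_simps)
  moreover have "(cmod (1 - of_real a * z))\<^sup>2 \<noteq> 0"
    using disc_aut_denominator_nonzero [OF assms] by simp
  ultimately show ?thesis
    unfolding cmod_disc_aut_factor_power2 [OF a] disc_aut_def norm_divide power_divide
    by (metis diff_divide_distrib divide_self times_divide_eq_right)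
qed

lemma disc_aut_factor_nonzero:
  assumes "\<bar>a\<bar> < 1" "cmod z \<le> 1"
  shows "disc_aut_factor a z \<noteq> 0"
proof -
  have "a\<^sup>2 < 1" using assms by (simp add: abs_square_less_1)
  then show ?thesis
    using disc_aut_denominator_nonzero [OF assms] by (simp add: disc_aut_factor_def)
qed

lemma cmod_disc_aut_less_1:
  assumes "\<bar>a\<bar> < 1" "cmod z < 1"
  shows "cmod (disc_aut a z) < 1"
proof -
  have "(1 - (cmod z)\<^sup>2) * (cmod (disc_aut_factor a z))\<^sup>2 > 0"
    using assms disc_aut_factor_nonzero [of a z]
    by (intro mult_pos_pos) (auto simp: abs_square_less_1)
  then have "(cmod (disc_aut a z))\<^sup>2 < 1"
    using one_minus_cmod_disc_aut [of a z] assms by simp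
  then show ?thesis by (simp add: abs_square_less_1)
qed

lemma disc_aut_in_disc: "\<bar>a\<bar> < 1 \<Longrightarrow> z \<in> unit_disc \<Longrightarrow> disc_aut a z \<in> unit_disc"
  using cmod_disc_aut_less_1 by simp

lemma cmod_disc_aut_eq_1:
  assumes "\<bar>a\<bar> < 1" "cmod z = 1"
  shows "cmod (disc_aut a z) = 1"
  proof -
  have "(cmod (disc_aut a z))\<^sup>2 = 1\<^sup>2"
    using one_minus_cmod_disc_aut [of a z] assms by simp
  then show ?thesis
    by (rule power2_eq_imp_eq) auto
qed

lemma disc_aut_minus_disc_aut:
  assumes a: "\<bar>a\<bar> < 1" and z: "cmod z \<le> 1"
  shows "disc_aut (- a) (disc_aut a z) = z"
    and "disc_aut_factor (- a) (disc_aut a z) = inverse (disc_aut_factor a z)"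
proof -
  define d where "d = 1 - of_real a * z"
  have d: "d \<noteq> 0" unfolding d_def by (rule disc_aut_denominator_nonzero [OF assms])
  have a2: "a\<^sup>2 < 1" using assms by (simp add: abs_square_less_1)
  then have "complex_of_real (1 - a\<^sup>2) \<noteq> 0"
    unfolding of_real_eq_0_iff by linarith
  then have a3: "(1 - (of_real a)\<^sup>2 :: complex) \<noteq> 0"
    by simp
  have m: "disc_aut a z = (z - of_real a) / d" by (simp add: disc_aut_def d_def)
  have "1 + of_real a * disc_aut a z = (d + of_real a * (z - of_real a)) / d"
    using d by (simp add: m add_divide_distrib)
  also have "d + of_real a * (z - of_real a) = 1 - (of_real a)\<^sup>2"
    by (simp add: d_def algebra_simps power2_eq_square)
  finally have den: "1 + of_real a * disc_aut a z = (1 - (of_real a)\<^sup>2) / d" .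
  have "disc_aut a z + of_real a = (z - of_real a + of_real a * d) / d"
    using d by (simp add: m add_divide_distrib)
  also have "z - of_real a + of_real a * d = (1 - (of_real a)\<^sup>2) * z"
    by (simp add: d_def algebra_simps power2_eq_square)
  finally have num: "disc_aut a z + of_real a = (1 - (of_real a)\<^sup>2) * z / d" .
  show "disc_aut (- a) (disc_aut a z) = z"
    using d a3 by (subst disc_aut_def) (simp add: den num)
  have sq: "1 - (of_real a)\<^sup>2 = (of_real (sqrt (1 - a\<^sup>2)) :: complex)\<^sup>2"
    using a2 by (simp flip: of_real_power)
  have "of_real (sqrt (1 - a\<^sup>2)) / ((1 - (of_real a)\<^sup>2) / d) = d / of_real (sqrt (1 - a\<^sup>2))"
    using a3 unfolding sq by (simp add: power2_eq_square)
  moreover have "disc_aut_factor (- a) (disc_aut a z) = of_real (sqrt (1 - a\<^sup>2)) / ((1 - (of_real a)\<^sup>2) / d)"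
    by (subst disc_aut_factor_def) (simp add: den)
  moreover have "inverse (disc_aut_factor a z) = d / of_real (sqrt (1 - a\<^sup>2))"
    by (simp add: disc_aut_factor_def d_def)
  ultimately show "disc_aut_factor (- a) (disc_aut a z) = inverse (disc_aut_factor a z)"
    by simp
qed

lemma disc_aut_image:
  assumes "\<bar>a\<bar> < 1"
  shows "disc_aut a ` unit_disc = unit_disc"
proof (intro equalityI subsetI)
  fix z assume z: "z \<in> unit_disc"
  have "disc_aut (- a) z \<in> unit_disc"
    by (rule disc_aut_in_disc) (use assms z in auto)
  moreover have "z = disc_aut a (disc_aut (- a) z)"
    using disc_aut_minus_disc_aut(1) [of "- a" z] assms z by simp
  ultimately show "z \<in> disc_aut a ` unit_disc" by (rule rev_image_eqI)
qed (use disc_aut_in_disc assms in blast)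

lemma inj_on_disc_aut: "\<bar>a\<bar> < 1 \<Longrightarrow> inj_on (disc_aut a) unit_disc"
  by (rule inj_on_inverseI [of _ "disc_aut (- a)"]) (auto simp: disc_aut_minus_disc_aut)

lemma holomorphic_on_disc_aut:
  assumes "\<And>z. z \<in> A \<Longrightarrow> 1 - of_real a * z \<noteq> 0"
  shows "disc_aut a holomorphic_on A" "disc_aut_factor a holomorphic_on A"
  unfolding disc_aut_def disc_aut_factor_def using assms
  by (auto intro!: holomorphic_intros)

lemma deriv_disc_aut:
  assumes "\<bar>a\<bar> < 1" "cmod z < 1"
  shows "deriv (disc_aut a) z = (disc_aut_factor a z)\<^sup>2"
proof -
  have a2: "a\<^sup>2 < 1" using assms by (simp add: abs_square_less_1)
  have "(disc_aut a has_field_derivative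
      (1 * (1 - of_real a * z) - (z - of_real a) * (- of_real a)) / ((1 - of_real a * z) * (1 - of_real a * z))) (at z)"
    unfolding disc_aut_def using disc_aut_denominator_nonzero [of a z] assms
    by (auto intro!: derivative_eq_intros)
  moreover have "1 * (1 - of_real a * z) - (z - of_real a) * (- of_real a) = (of_real (sqrt (1 - a\<^sup>2)))\<^sup>2"
    using a2 by (simp add: algebra_simps power2_eq_square flip: of_real_mult)
  ultimately show ?thesis
    by (intro DERIV_imp_deriv) (simp add: disc_aut_factor_def power_divide power2_eq_square)
qed

section \<open>Consequences of Fatou's lemma\<close>

lemma nn_integral_le_of_pointwise_limit:
  assumes u: "\<And>n. u n \<in> borel_measurable M"
    and lim: "\<And>x. x \<in> space M \<Longrightarrow> (\<lambda>n. u n x) \<longlonglongrightarrow> v x"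
    and le: "\<And>n. (\<integral>\<^sup>+ x. u n x \<partial>M) \<le> (C :: ennreal)"
  shows "(\<integral>\<^sup>+ x. v x \<partial>M) \<le> C"
proof -
  have "(\<integral>\<^sup>+ x. v x \<partial>M) = (\<integral>\<^sup>+ x. liminf (\<lambda>n. u n x) \<partial>M)"
    by (intro nn_integral_cong lim_imp_Liminf [symmetric] lim) auto
  also have "\<dots> \<le> liminf (\<lambda>n. \<integral>\<^sup>+ x. u n x \<partial>M)"
    by (rule nn_integral_liminf [OF u])
  also have "\<dots> \<le> liminf (\<lambda>n. C)"
    by (intro Liminf_mono always_eventually allI le)
  also have "\<dots> = C" by (simp add: Liminf_const)
  finally show ?thesis .
qed

lemma circle_energy_le_of_pointwise_limit:
  assumes cont: "\<And>n. continuous_on UNIV (\<lambda>t. F n (w n * cis t))"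
    and lim: "\<And>t. (\<lambda>n. F n (w n * cis t)) \<longlonglongrightarrow> G (z * cis t)"
    and le: "\<And>n. circle_energy (F n) (w n) \<le> C"
  shows "circle_energy G z \<le> C"
  unfolding circle_energy_def
proof (rule nn_integral_le_of_pointwise_limit)
  fix n
  have [measurable]: "(\<lambda>t. F n (w n * cis t)) \<in> borel_measurable borel"
    by (rule borel_measurable_continuous_onI [OF cont])
  show "(\<lambda>t. ennreal ((cmod (F n (w n * cis t)))\<^sup>2) * indicator {0..2 * pi} t) \<in> borel_measurable lborel"
    by measurable
  show "(\<integral>\<^sup>+ t\<in>{0..2 * pi}. ennreal ((cmod (F n (w n * cis t)))\<^sup>2) \<partial>lborel) \<le> C"
    using le [of n] by (simp add: circle_energy_def)
next
  fix t
  have "(\<lambda>n. ennreal ((cmod (F n (w n * cis t)))\<^sup>2)) \<longlonglongrightarrow> ennreal ((cmod (G (z * cis t)))\<^sup>2)"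
    by (intro tendsto_intros lim)
  then show "(\<lambda>n. ennreal ((cmod (F n (w n * cis t)))\<^sup>2) * indicator {0..2 * pi} t)
      \<longlonglongrightarrow> ennreal ((cmod (G (z * cis t)))\<^sup>2) * indicator {0..2 * pi} t"
    by (cases "t \<in> {0..2 * pi}") auto
qed

section \<open>Disc automorphisms and the Hardy norm\<close>

text \<open>
  The weight is the Poisson kernel of the point \<open>a\<close>. On the unit circle the conjugate of \<open>u\<close> is
  \<open>1 / u\<close>, so the kernel times arc length is a holomorphic function over \<open>u - a\<close>, and Cauchy's
  integral formula applies.
\<close>

lemma poisson_integral_circle:
  fixes G :: "complex \<Rightarrow> complex"
  assumes a: "\<bar>a\<bar> < 1" and G: "continuous_on (cball 0 1) G" "G holomorphic_on ball 0 1"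
  shows "((\<lambda>t. G (cis t) * of_real ((cmod (disc_aut_factor a (cis t)))\<^sup>2)) has_integral
            2 * pi * G (of_real a)) {0..2 * pi}"
proof -
  have a2: "1 - a\<^sup>2 > 0" using a by (simp add: abs_square_less_1)
  have nz: "1 - of_real a * z \<noteq> 0" if "cmod z \<le> 1" for z :: complex
    by (rule disc_aut_denominator_nonzero [OF a that])
  have "((\<lambda>u. (G u / (1 - of_real a * u)) / (u - of_real a)) has_contour_integral
      (2 * of_real pi * \<i> * (G (of_real a) / (1 - of_real a * of_real a)))) (circlepath 0 1)"
    by (rule Cauchy_integral_circlepath)
       (use a nz in \<open>auto intro!: continuous_intros holomorphic_intros G\<close>)
  then have "((\<lambda>t. (G (cis t) / (1 - of_real a * cis t)) / (cis t - of_real a) * \<i> * cis t) has_integral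
      (2 * of_real pi * \<i> * (G (of_real a) / (1 - of_real a * of_real a)))) {0..2 * pi}"
    unfolding circlepath_def by (subst (asm) has_contour_integral_part_circlepath_iff) auto
  then have "((\<lambda>t. (- \<i> * of_real (1 - a\<^sup>2)) * ((G (cis t) / (1 - of_real a * cis t)) / (cis t - of_real a) * \<i> * cis t)) has_integral
      ((- \<i> * of_real (1 - a\<^sup>2)) * (2 * of_real pi * \<i> * (G (of_real a) / (1 - of_real a * of_real a))))) {0..2 * pi}"
    by (rule has_integral_mult_right)
  moreover have "(- \<i> * of_real (1 - a\<^sup>2)) * ((G (cis t) / (1 - of_real a * cis t)) / (cis t - of_real a) * \<i> * cis t)
      = G (cis t) * of_real ((cmod (disc_aut_factor a (cis t)))\<^sup>2)" for t
  proof -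
    define c where "c = cis t"
    have c: "c \<noteq> 0" "c * cnj c = 1" "cmod c = 1" by (auto simp: c_def cis_cnj cis_mult)
    have "of_real ((cmod (1 - of_real a * c))\<^sup>2) = (1 - of_real a * c) * (1 - of_real a * cnj c)"
      by (simp only: complex_norm_square) simp
    also have "1 - of_real a * cnj c = (c - of_real a) / c"
    proof -
      have "(1 - of_real a * cnj c) * c = c - of_real a * (c * cnj c)"
        by (simp add: algebra_simps)
      then show ?thesis using c(1) unfolding c(2) by (simp add: field_simps)
    qed
    finally have "of_real ((cmod (disc_aut_factor a c))\<^sup>2)
        = of_real (1 - a\<^sup>2) / ((1 - of_real a * c) * ((c - of_real a) / c))"
      by (simp add: cmod_disc_aut_factor_power2 [OF a])
    then show ?thesis unfolding c_def [symmetric] using c(1) by (simp add: field_simps)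
  qed
  moreover have "(- \<i> * of_real (1 - a\<^sup>2)) * (2 * of_real pi * \<i> * (G (of_real a) / (1 - of_real a * of_real a)))
      = 2 * pi * G (of_real a)"
  proof -
    have "(of_real (1 - a\<^sup>2) :: complex) \<noteq> 0" using a2 by (simp only: of_real_eq_0_iff)
    then show ?thesis by (simp add: power2_eq_square field_simps)
  qed
  ultimately show ?thesis by (simp only:)
qed

text \<open>
  On the unit circle the automorphism has modulus 1, so a product of one power with a conjugate power is
  again a power. Its Poisson integral is its value at \<open>a\<close>, where the automorphism vanishes.
\<close>

lemma disc_aut_powers_orthogonal:
  assumes a: "\<bar>a\<bar> < 1"
  shows "((\<lambda>t. (disc_aut a (cis t) ^ j * disc_aut_factor a (cis t)) * cnj (disc_aut a (cis t) ^ k * disc_aut_factor a (cis t)))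
     has_integral (if j = k then 2 * pi else 0)) {0..2 * pi}"
proof -
  have le: "((\<lambda>t. (disc_aut a (cis t) ^ j * disc_aut_factor a (cis t)) * cnj (disc_aut a (cis t) ^ k * disc_aut_factor a (cis t)))
     has_integral (if j = k then 2 * pi else 0)) {0..2 * pi}" if jk: "k \<le> j" for j k
  proof -
    have holo: "disc_aut a holomorphic_on cball 0 1"
      by (rule holomorphic_on_disc_aut) (use disc_aut_denominator_nonzero [OF a] in auto)
    have "((\<lambda>t. disc_aut a (cis t) ^ (j - k) * of_real ((cmod (disc_aut_factor a (cis t)))\<^sup>2)) has_integral
            2 * pi * disc_aut a (of_real a) ^ (j - k)) {0..2 * pi}"
      by (rule poisson_integral_circle [OF a, of "\<lambda>u. disc_aut a u ^ (j - k)"])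
         (auto intro!: continuous_intros holomorphic_intros holomorphic_on_imp_continuous_on holo
            holomorphic_on_subset [OF holo])
    moreover have "disc_aut a (cis t) ^ (j - k) * of_real ((cmod (disc_aut_factor a (cis t)))\<^sup>2)
        = (disc_aut a (cis t) ^ j * disc_aut_factor a (cis t)) * cnj (disc_aut a (cis t) ^ k * disc_aut_factor a (cis t))" for t
    proof -
      define m where "m = disc_aut a (cis t)"
      have "m * cnj m = of_real ((cmod m)\<^sup>2)" by (simp only: complex_norm_square)
      then have m: "m * cnj m = 1" using cmod_disc_aut_eq_1 [OF a] by (simp add: m_def)
      have "m ^ j * cnj m ^ k = m ^ (j - k) * (m * cnj m) ^ k"
        using jk by (simp add: power_mult_distrib mult_ac flip: power_add)
      then show ?thesis
        unfolding m_def [symmetric] complex_norm_square by (simp add: m mult_ac)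
    qed
    moreover have "2 * pi * disc_aut a (of_real a) ^ (j - k) = (if j = k then 2 * pi else 0)"
      using jk by (auto simp: disc_aut_def)
    ultimately show ?thesis by (simp only:)
  qed
  show ?thesis
  proof (cases "k \<le> j")
    case True then show ?thesis by (rule le)
  next
    case False
    from has_integral_cnj [THEN iffD2, OF le [of j k]] False show ?thesis
      by (simp add: mult_ac o_def cong: if_cong)
  qed
qed

lemma circle_energy_disc_aut_sum:
  assumes a: "\<bar>a\<bar> < 1" and S: "finite S"
  shows "circle_energy (\<lambda>z. (\<Sum>k\<in>S. c k * disc_aut a z ^ k) * disc_aut_factor a z) 1
       = ennreal (2 * pi * (\<Sum>k\<in>S. (cmod (c k))\<^sup>2))"
proof -
  define e where "e k t = disc_aut a (cis t) ^ k * disc_aut_factor a (cis t)" for k t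
  define F where "F t = (\<Sum>k\<in>S. c k * e k t)" for t
  have "((\<lambda>t. \<Sum>j\<in>S. \<Sum>k\<in>S. (c j * cnj (c k)) * (e j t * cnj (e k t))) has_integral
      (\<Sum>j\<in>S. \<Sum>k\<in>S. (c j * cnj (c k)) * of_real (if j = k then 2 * pi else 0))) {0..2 * pi}"
    unfolding e_def
    by (intro has_integral_sum S has_integral_mult_right disc_aut_powers_orthogonal [OF a])
  also have "(\<lambda>t. \<Sum>j\<in>S. \<Sum>k\<in>S. (c j * cnj (c k)) * (e j t * cnj (e k t))) = (\<lambda>t. of_real ((cmod (F t))\<^sup>2))"
    unfolding complex_norm_square F_def cnj_sum sum_product by (simp add: mult_ac)
  also have "(\<Sum>j\<in>S. \<Sum>k\<in>S. (c j * cnj (c k)) * of_real (if j = k then 2 * pi else 0))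
      = of_real (2 * pi * (\<Sum>k\<in>S. (cmod (c k))\<^sup>2))"
    unfolding of_real_mult of_real_sum complex_norm_square using S
    by (simp add: if_distrib sum_distrib_left mult_ac cong: if_cong)
  finally have "((\<lambda>t. complex_of_real ((cmod (F t))\<^sup>2)) has_integral
      of_real (2 * pi * (\<Sum>k\<in>S. (cmod (c k))\<^sup>2))) {0..2 * pi}" .
  from has_integral_linear [OF this bounded_linear_Re]
  have "((\<lambda>t. (cmod (F t))\<^sup>2) has_integral 2 * pi * (\<Sum>k\<in>S. (cmod (c k))\<^sup>2)) {0..2 * pi}"
    by (simp only: o_def Re_complex_of_real)
  then have "(\<integral>\<^sup>+ t\<in>{0..2 * pi}. ennreal ((cmod (F t))\<^sup>2) \<partial>lborel) = ennreal (2 * pi * (\<Sum>k\<in>S. (cmod (c k))\<^sup>2))"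
    by (intro nn_integral_has_integral_lebesgue') auto
  moreover have "F t = (\<Sum>k\<in>S. c k * disc_aut a (cis t) ^ k) * disc_aut_factor a (cis t)" for t
    by (simp add: F_def e_def sum_distrib_right mult.assoc)
  ultimately show ?thesis
    by (simp add: circle_energy_def)
qed

text \<open>
  The case \<open>a = 0\<close>, in which the automorphism is the identity, with the radius put into the coefficients.
\<close>

lemma circle_energy_polynomial:
  assumes S: "finite S"
  shows "circle_energy (\<lambda>z. \<Sum>k\<in>S. c k * z ^ k) w
       = ennreal (2 * pi * (\<Sum>k\<in>S. (cmod (c k * w ^ k))\<^sup>2))"
  using circle_energy_disc_aut_sum [of 0 S "\<lambda>k. c k * w ^ k"] S
  by (simp add: disc_aut_def disc_aut_factor_def circle_energy_def power_mult_distrib mult_ac)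

lemma taylor_part_tendsto:
  assumes "f holomorphic_on ball 0 R" "cmod z < R"
  shows "(\<lambda>n. taylor_part {..<n} f z) \<longlonglongrightarrow> f z"
  using holomorphic_power_series [of f 0 R z] assms
  by (simp add: taylor_part_def sums_def)

text \<open>
  For Taylor polynomials the circle integrals increase with the radius by Parseval's formula; on the unit
  circle they are bounded by that of \<open>F\<close>, and Fatou's lemma returns to \<open>F\<close> on the inner circle.
\<close>

lemma circle_energy_le_unit_circle:
  assumes F: "F holomorphic_on ball 0 R" and R: "R > 1" and z: "cmod z \<le> 1"
  shows "circle_energy F z \<le> circle_energy F 1"
proof (rule circle_energy_le_of_pointwise_limit)
  show "continuous_on UNIV (\<lambda>t. taylor_part {..<n} F (z * cis t))" for n
    unfolding taylor_part_def by (intro continuous_intros) auto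
  show "(\<lambda>n. taylor_part {..<n} F (z * cis t)) \<longlonglongrightarrow> F (z * cis t)" for t
    by (rule taylor_part_tendsto [OF F]) (use R z in \<open>simp add: norm_mult\<close>)
  show "circle_energy (taylor_part {..<n} F) z \<le> circle_energy F 1" for n
  proof -
    define c where "c k = (deriv ^^ k) F 0 / fact k" for k
    have "circle_energy (taylor_part {..<n} F) z = ennreal (2 * pi * (\<Sum>k<n. (cmod (c k * z ^ k))\<^sup>2))"
      unfolding taylor_part_def [abs_def] c_def by (rule circle_energy_polynomial) simp
    also have "\<dots> \<le> ennreal (2 * pi * (\<Sum>k<n. (cmod (c k * 1 ^ k))\<^sup>2))"
      using z by (intro ennreal_leI mult_left_mono sum_mono power_mono)
        (auto simp: norm_mult norm_power intro!: mult_left_le power_le_one)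
    also have "\<dots> = circle_energy (taylor_part {..<n} F) 1"
      unfolding taylor_part_def [abs_def] c_def by (rule circle_energy_polynomial [symmetric]) simp
    also have "\<dots> \<le> circle_energy F 1"
      by (rule circle_energy_taylor_part_le [OF F]) (use R in auto)
    finally show ?thesis .
  qed
qed

text \<open>
  Weighted translation is contractive on \<open>H\<^sup>2\<close>. For a Taylor polynomial of \<open>f\<close> the translate extends beyond
  the closed disc, and on the unit circle its square mean equals that of the polynomial by orthogonality.
  Fatou's lemma is used twice: to reach the unit circle from inside, and to pass from Taylor polynomials to \<open>f\<close>.
\<close>

lemma circle_energy_disc_aut_le:
  assumes a: "0 < a" "a < 1" and f: "f holomorphic_on unit_disc"
    and C: "\<And>r. r \<in> {0<..<1} \<Longrightarrow> circle_energy f (of_real r) \<le> C"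
    and z: "cmod z < 1"
  shows "circle_energy (\<lambda>z. f (disc_aut a z) * disc_aut_factor a z) z \<le> C"
proof (rule circle_energy_le_of_pointwise_limit)
  have a': "\<bar>a\<bar> < 1" using a by simp
  define V where "V n z = taylor_part {..<n} f (disc_aut a z) * disc_aut_factor a z" for n z
  have nz: "1 - of_real a * u \<noteq> 0" if "u \<in> ball 0 (1 / a)" for u :: complex
  proof
    assume "1 - of_real a * u = 0"
    then have "of_real a * u = 1" by simp
    then have "cmod (of_real a * u) = 1" by simp
    then have "a * cmod u = 1" using a by (simp add: norm_mult)
    then show False using that a by (simp add: field_simps)
  qed
  have V: "V n holomorphic_on ball 0 (1 / a)" for n
    unfolding V_def [abs_def] taylor_part_def
    by (intro holomorphic_intros holomorphic_on_disc_aut nz) auto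
  \<comment> \<open>The translate of a polynomial has its only pole at 1 / a, outside the closed disc.\<close>
  have R: "1 < 1 / a" using a by simp
  show "continuous_on UNIV (\<lambda>t. V n (z * cis t))" for n
    by (rule continuous_on_circle [OF holomorphic_on_imp_continuous_on [OF V]]) (use z R in linarith)
  show "(\<lambda>n. V n (z * cis t)) \<longlonglongrightarrow> f (disc_aut a (z * cis t)) * disc_aut_factor a (z * cis t)" for t
    unfolding V_def using z
    by (intro tendsto_intros taylor_part_tendsto [OF f] cmod_disc_aut_less_1 a') (simp add: norm_mult)
  show "circle_energy (V n) z \<le> C" for n
  proof -
    define c where "c k = (deriv ^^ k) f 0 / fact k" for k
    have "circle_energy (V n) z \<le> circle_energy (V n) 1"
      by (rule circle_energy_le_unit_circle [OF V R]) (use z in simp)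
    also have "\<dots> = ennreal (2 * pi * (\<Sum>k<n. (cmod (c k))\<^sup>2))"
      unfolding V_def taylor_part_def c_def by (rule circle_energy_disc_aut_sum [OF a']) simp
    also have "\<dots> = circle_energy (taylor_part {..<n} f) 1"
      unfolding taylor_part_def [abs_def] c_def by (subst circle_energy_polynomial) auto
    also have "\<dots> \<le> C"
    proof (rule circle_energy_le_of_pointwise_limit)
      define s :: "nat \<Rightarrow> real" where "s m = 1 - 1 / real (m + 2)" for m
      have s: "s m \<in> {0<..<1}" for m by (simp add: s_def field_simps)
      have "s \<longlonglongrightarrow> 1 - 0"
        unfolding s_def by (intro tendsto_intros LIMSEQ_ignore_initial_segment [OF lim_1_over_n])
      then have s1: "(\<lambda>m. complex_of_real (s m)) \<longlonglongrightarrow> 1"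
        using tendsto_of_real [of s 1 sequentially] by simp
      show "continuous_on UNIV (\<lambda>t. taylor_part {..<n} f (of_real (s m) * cis t))" for m
        unfolding taylor_part_def by (intro continuous_intros) auto
      show "(\<lambda>m. taylor_part {..<n} f (of_real (s m) * cis t)) \<longlonglongrightarrow> taylor_part {..<n} f (1 * cis t)" for t
        unfolding taylor_part_def by (intro tendsto_intros s1) 
      show "circle_energy (taylor_part {..<n} f) (of_real (s m)) \<le> C" for m
        using circle_energy_taylor_part_le(1) [OF f, of "of_real (s m)" "{..<n}"] C [OF s [of m]] s [of m]
        by (auto intro: order_trans)
    qed
    finally show ?thesis .
  qed
qed

section \<open>Weighted translations\<close>

text \<open>
  For \<open>s = \<alpha> + 2\<close> this is the isometric action \<open>f \<mapsto> f \<circ> \<phi> \<cdot> (\<phi>')\<^bsup>s/2\<^esup>\<close> of an automorphism \<open>\<phi>\<close>. The principal branch of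
  the power is holomorphic because the factor has positive real part.
\<close>

definition disc_translate :: "real \<Rightarrow> real \<Rightarrow> (complex \<Rightarrow> complex) \<Rightarrow> complex \<Rightarrow> complex" where
  "disc_translate s a f z = f (disc_aut a z) * disc_aut_factor a z powr of_real s"

lemma disc_aut_factor_not_nonpos_Real:
  assumes a: "\<bar>a\<bar> < 1" and z: "cmod z \<le> 1"
  shows "disc_aut_factor a z \<notin> \<real>\<^sub>\<le>\<^sub>0"
proof -
  have a2: "1 - a\<^sup>2 > 0" using a by (simp add: abs_square_less_1)
  have "\<bar>a * Re z\<bar> \<le> \<bar>a\<bar> * 1"
    unfolding abs_mult using abs_Re_le_cmod [of z] z by (intro mult_left_mono) auto
  then have "Re (1 - of_real a * z) > 0" using a by simp
  then have "Re (disc_aut_factor a z) > 0"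
    using a2 disc_aut_denominator_nonzero [OF assms]
    unfolding disc_aut_factor_def Re_divide_of_real
    by (simp add: Re_divide add_pos_nonneg sum_power2_gt_zero_iff complex_neq_0)
  then show ?thesis by (auto simp: complex_nonpos_Reals_iff)
qed

lemma holomorphic_on_disc_translate:
  assumes a: "\<bar>a\<bar> < 1" and f: "f holomorphic_on unit_disc"
  shows "disc_translate s a f holomorphic_on unit_disc"
proof -
  have nz: "1 - of_real a * z \<noteq> 0" if "z \<in> unit_disc" for z :: complex
    using disc_aut_denominator_nonzero [OF a, of z] that by simp
  have "(f \<circ> disc_aut a) holomorphic_on unit_disc"
    by (rule holomorphic_on_compose_gen [OF holomorphic_on_disc_aut(1) [OF nz] f])
      (use disc_aut_in_disc [OF a] in auto)
  then show ?thesis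
    unfolding disc_translate_def [abs_def] o_def
    by (intro holomorphic_intros holomorphic_on_disc_aut nz)
       (use disc_aut_factor_not_nonpos_Real [OF a] in auto)
qed

lemma cmod_disc_translate:
  "cmod (disc_translate s a f z) = cmod (f (disc_aut a z)) * cmod (disc_aut_factor a z) powr s"
  by (simp add: disc_translate_def norm_mult norm_powr_real_powr')

lemma disc_translate_inverse:
  assumes a: "\<bar>a\<bar> < 1" and z: "z \<in> unit_disc"
  shows "disc_translate s (- a) (disc_translate s a f) z = f z"
proof -
  define w where "w = disc_aut_factor (- a) z"
  have w: "w \<notin> \<real>\<^sub>\<le>\<^sub>0" "w \<noteq> 0"
    using disc_aut_factor_not_nonpos_Real [of "- a" z] disc_aut_factor_nonzero [of "- a" z] a z
    by (auto simp: w_def)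
  have "inverse w powr of_real s * w powr of_real s = 1"
    using w by (simp add: powr_def Ln_inverse flip: exp_add)
  then show ?thesis
    using disc_aut_minus_disc_aut [of "- a" z] a z
    by (simp add: disc_translate_def mult.assoc flip: w_def)
qed

section \<open>Translations and the Bergman norms\<close>

lemma measurable_weighted_power:
  assumes f: "continuous_on unit_disc f"
  shows "(\<lambda>z. ennreal ((1 - (cmod z)\<^sup>2) powr \<beta> * cmod (f z) powr q) * indicator unit_disc z)
    \<in> borel_measurable borel"
proof -
  define F where "F z = indicator unit_disc z *\<^sub>R f z" for z
  have "F \<in> borel_measurable borel"
    unfolding F_def by (rule borel_measurable_continuous_on_indicator) (auto simp: f)
  then have "(\<lambda>z. ennreal ((1 - (cmod z)\<^sup>2) powr \<beta> * cmod (F z) powr q) * indicator unit_disc z)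
      \<in> borel_measurable borel"
    by (intro borel_measurable_times_ennreal borel_measurable_indicator) simp_all
  also have "(\<lambda>z. ennreal ((1 - (cmod z)\<^sup>2) powr \<beta> * cmod (F z) powr q) * indicator unit_disc z)
     = (\<lambda>z. ennreal ((1 - (cmod z)\<^sup>2) powr \<beta> * cmod (f z) powr q) * indicator unit_disc z)"
    by (auto simp: F_def indicator_def)
  finally show ?thesis .
qed

text \<open>
  The powers of the factor match: \<open>\<beta>\<close> from the weight at \<open>\<phi> z\<close> and \<open>2\<close> from the Jacobian, each
  on the squared modulus, make up the exponent \<open>q * s\<close> on the modulus. For given \<open>s\<close> this holds for
  \<open>(q, \<beta>) = (2, s - 2)\<close> and for \<open>(q, \<beta>) = (p, p / 2 * s - 2)\<close>, the two norms to be compared.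
\<close>

lemma nn_integral_disc_translate:
  assumes a: "\<bar>a\<bar> < 1" and f: "continuous_on unit_disc f" and eq: "\<beta> + 2 = q * s / 2"
  shows "(\<integral>\<^sup>+ z\<in>unit_disc. ennreal ((1 - (cmod z)\<^sup>2) powr \<beta> * cmod (disc_translate s a f z) powr q) \<partial>lborel)
       = (\<integral>\<^sup>+ z\<in>unit_disc. ennreal ((1 - (cmod z)\<^sup>2) powr \<beta> * cmod (f z) powr q) \<partial>lborel)"
proof -
  define g where "g z = ennreal ((1 - (cmod z)\<^sup>2) powr \<beta> * cmod (f z) powr q) * indicator unit_disc z" for z
  have nz: "1 - of_real a * z \<noteq> 0" if "z \<in> unit_disc" for z :: complex
    using disc_aut_denominator_nonzero [OF a, of z] that by simp
  have "disc_aut a holomorphic_on unit_disc"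
    by (rule holomorphic_on_disc_aut(1) [OF nz])
  then have "(\<integral>\<^sup>+ w\<in>unit_disc. g w \<partial>lborel)
      = (\<integral>\<^sup>+ z\<in>unit_disc. g (disc_aut a z) * ennreal ((cmod (deriv (disc_aut a) z))\<^sup>2) \<partial>lborel)"
    using nn_integral_holomorphic_image [of "disc_aut a" unit_disc g]
      inj_on_disc_aut [OF a] measurable_weighted_power [OF f] disc_aut_image [OF a]
    by (simp add: g_def [abs_def])
  also have "\<dots> = (\<integral>\<^sup>+ z\<in>unit_disc. ennreal ((1 - (cmod z)\<^sup>2) powr \<beta> * cmod (disc_translate s a f z) powr q) \<partial>lborel)"
  proof (intro nn_integral_cong)
    fix z :: complex
    show "g (disc_aut a z) * ennreal ((cmod (deriv (disc_aut a) z))\<^sup>2) * indicator unit_disc z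
      = ennreal ((1 - (cmod z)\<^sup>2) powr \<beta> * cmod (disc_translate s a f z) powr q) * indicator unit_disc z"
    proof (cases "z \<in> unit_disc")
      case True
      define x where "x = 1 - (cmod z)\<^sup>2"
      define m where "m = cmod (disc_aut_factor a z)"
      define y where "y = cmod (f (disc_aut a z))"
      have x: "x > 0" using True by (simp add: x_def abs_square_less_1)
      have m: "m > 0" using disc_aut_factor_nonzero [OF a] True by (simp add: m_def)
      have m_powr: "m\<^sup>2 = m powr 2" "m ^ 4 = m powr 4" using m by simp_all
      have "(x * m\<^sup>2) powr \<beta> * m ^ 4 = x powr \<beta> * (m powr (2 * \<beta>) * m powr 4)"
        unfolding m_powr using x m by (simp only: powr_mult powr_powr mult.assoc)
      also have "m powr (2 * \<beta>) * m powr 4 = m powr (2 * \<beta> + 4)"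
        by (rule powr_add [symmetric])
      also have "2 * \<beta> + 4 = s * q" using eq by (simp add: field_simps)
      finally have "(x * m\<^sup>2) powr \<beta> * m ^ 4 = x powr \<beta> * m powr (s * q)" .
      then have "((x * m\<^sup>2) powr \<beta> * m ^ 4) * y powr q = x powr \<beta> * (y powr q * m powr (s * q))"
        by simp
      also have "y powr q * m powr (s * q) = (y * m powr s) powr q"
        by (simp add: powr_mult powr_powr y_def)
      finally have "(x * m\<^sup>2) powr \<beta> * y powr q * m ^ 4 = x powr \<beta> * (y * m powr s) powr q"
        by (simp only: mult_ac)
      moreover have "g (disc_aut a z) = ennreal ((x * m\<^sup>2) powr \<beta> * y powr q)"
        using one_minus_cmod_disc_aut [OF a, of z] disc_aut_in_disc [OF a True] True
        by (simp add: g_def x_def m_def y_def)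
      moreover have "(cmod (deriv (disc_aut a) z))\<^sup>2 = m ^ 4"
        using deriv_disc_aut [OF a, of z] True by (simp add: m_def norm_power)
      ultimately show ?thesis
        using True by (simp add: cmod_disc_translate x_def m_def y_def flip: ennreal_mult)
    qed simp
  qed
  also have "(\<integral>\<^sup>+ w\<in>unit_disc. g w \<partial>lborel)
      = (\<integral>\<^sup>+ z\<in>unit_disc. ennreal ((1 - (cmod z)\<^sup>2) powr \<beta> * cmod (f z) powr q) \<partial>lborel)"
    by (intro nn_integral_cong) (simp add: g_def indicator_def)
  finally show ?thesis by simp
qed

lemma bergman_norm_disc_translate:
  assumes a: "\<bar>a\<bar> < 1" and f: "f holomorphic_on unit_disc" and eq: "\<beta> + 2 = q * s / 2" and \<beta>: "\<beta> \<noteq> -1"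
  shows "bergman_norm q \<beta> (disc_translate s a f) = bergman_norm q \<beta> f"
  using holomorphic_on_disc_translate [OF a f] f \<beta>
  by (simp add: bergman_norm_area holomorphic_on_imp_continuous_on
      nn_integral_disc_translate [OF a _ eq])

lemma bergman_norm_2_disc_translate_le_1:
  assumes a: "0 < a" "a < 1" and f: "f holomorphic_on unit_disc"
    and le: "bergman_norm 2 \<alpha> f \<le> 1"
  shows "bergman_norm 2 \<alpha> (disc_translate (\<alpha> + 2) a f) \<le> 1"
proof (cases "\<alpha> = -1")
  case False
  then show ?thesis using bergman_norm_disc_translate [of a f \<alpha> 2 "\<alpha> + 2"] a f le by simp
next
  case True
  have C: "circle_energy f (of_real r) \<le> ennreal (2 * pi)" if "r \<in> {0<..<1}" for r
    using le True that by (simp add: bergman_norm_def hardy_norm_2_le_1_iff)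
  have "disc_aut_factor a z powr 1 = disc_aut_factor a z" for z
    by (simp add: powr_def)
  then have "disc_translate 1 a f = (\<lambda>z. f (disc_aut a z) * disc_aut_factor a z)"
    by (simp add: disc_translate_def [abs_def])
  then show ?thesis
    using True circle_energy_disc_aut_le [OF a f C]
    by (simp add: bergman_norm_def hardy_norm_2_le_1_iff)
qed

lemma bergman_norm_le_of_pointwise_limit:
  assumes q: "q > 0" and \<beta>: "\<beta> \<noteq> -1"
    and h: "\<And>n. continuous_on unit_disc (h n)" and f: "continuous_on unit_disc f"
    and lim: "\<And>z. z \<in> unit_disc \<Longrightarrow> (\<lambda>n. h n z) \<longlonglongrightarrow> f z"
    and le: "\<And>n. bergman_norm q \<beta> (h n) \<le> B"
  shows "bergman_norm q \<beta> f \<le> B"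
proof -
  define D where "D g z = ennreal ((1 - (cmod z)\<^sup>2) powr \<beta> * cmod (g z) powr q) * indicator unit_disc z"
    for g :: "complex \<Rightarrow> complex" and z
  have M: "D g \<in> borel_measurable lborel" if "continuous_on unit_disc g" for g
    using measurable_weighted_power [OF that] by (simp add: D_def [abs_def])
  have iff: "bergman_norm q \<beta> g \<le> B \<longleftrightarrow>
      (\<integral>\<^sup>+ z. ennreal (\<beta> + 1) * (ennreal (1 / pi) * D g z) \<partial>lborel) \<le> ennreal_powr B q"
    if g: "continuous_on unit_disc g" for g
    using q M [OF g] unfolding bergman_norm_area [OF g \<beta>]
    by (simp add: ennreal_powr_le_iff nn_integral_cmult) (simp add: D_def)
  have "(\<integral>\<^sup>+ z. ennreal (\<beta> + 1) * (ennreal (1 / pi) * D f z) \<partial>lborel) \<le> ennreal_powr B q"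
  proof (rule nn_integral_le_of_pointwise_limit)
    show "(\<lambda>z. ennreal (\<beta> + 1) * (ennreal (1 / pi) * D (h n) z)) \<in> borel_measurable lborel" for n
      using M [OF h [of n]] by measurable
    show "(\<integral>\<^sup>+ z. ennreal (\<beta> + 1) * (ennreal (1 / pi) * D (h n) z) \<partial>lborel) \<le> ennreal_powr B q" for n
      using le [of n] iff [OF h] by blast
    fix z :: complex
    show "(\<lambda>n. ennreal (\<beta> + 1) * (ennreal (1 / pi) * D (h n) z))
        \<longlonglongrightarrow> ennreal (\<beta> + 1) * (ennreal (1 / pi) * D f z)"
    proof (cases "z \<in> unit_disc")
      case True
      have "(\<lambda>n. cmod (h n z) powr q) \<longlonglongrightarrow> cmod (f z) powr q"
        using q by (intro tendsto_powr2 tendsto_norm lim True tendsto_const) auto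
      then have "(\<lambda>n. D (h n) z) \<longlonglongrightarrow> D f z"
        using True unfolding D_def by (auto intro!: tendsto_intros)
      then show ?thesis by (intro ennreal_tendsto_cmult) auto
    qed (simp add: D_def)
  qed
  then show ?thesis using iff [OF f] by blast
qed

section \<open>Vanishing conditions cost nothing\<close>

text \<open>
  Let \<open>g\<^sub>n\<close> be the translate of \<open>f\<close> by \<open>a\<^sub>n \<rightarrow> 1\<close>, minus its Taylor terms with indices in \<open>\<Lambda>\<close>. Then \<open>g\<^sub>n\<close>
  satisfies the vanishing conditions and has \<open>A\<^sup>2\<^sub>\<alpha>\<close> norm at most 1. Translating \<open>g\<^sub>n\<close> back preserves its
  target norm and gives \<open>f\<close> minus the back-translate of a polynomial with bounded coefficients, which
  tends to 0 pointwise.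
\<close>

lemma bergman_norm_le_vanishing_bound:
  fixes \<Lambda> :: "nat set" and \<alpha> p :: real
  assumes \<Lambda>: "finite \<Lambda>" and \<alpha>: "\<alpha> \<ge> -1" and p: "p > 2"
    and f: "f holomorphic_on unit_disc" "bergman_norm 2 \<alpha> f \<le> 1"
    and B: "\<And>g. g holomorphic_on unit_disc \<Longrightarrow> bergman_norm 2 \<alpha> g \<le> 1 \<Longrightarrow>
              (\<forall>j\<in>\<Lambda>. (deriv ^^ j) g 0 = 0) \<Longrightarrow> bergman_norm p (p / 2 * (\<alpha> + 2) - 2) g \<le> B"
  shows "bergman_norm p (p / 2 * (\<alpha> + 2) - 2) f \<le> B"
proof -
  define s where "s = \<alpha> + 2"
  define \<beta> where "\<beta> = p / 2 * s - 2"
  have s: "s \<ge> 1" using \<alpha> by (simp add: s_def)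
  have "p * 1 \<le> p * s" using p s by (intro mult_left_mono) auto
  then have "p * s > 2" using p by linarith
  then have \<beta>: "\<beta> \<noteq> -1" "\<beta> + 2 = p * s / 2"
    by (auto simp: \<beta>_def)
  define a :: "nat \<Rightarrow> real" where "a n = 1 - 1 / real (n + 2)" for n
  have a: "0 < a n" "a n < 1" for n by (simp_all add: a_def field_simps)
  have a_abs: "\<bar>a n\<bar> < 1" "\<bar>- a n\<bar> < 1" for n using a [of n] by auto
  have "a \<longlonglongrightarrow> 1 - 0"
    unfolding a_def by (intro tendsto_intros LIMSEQ_ignore_initial_segment [OF lim_1_over_n])
  then have a1: "a \<longlonglongrightarrow> 1" by simp
  define u where "u n = disc_translate s (a n) f" for n
  define P where "P n = taylor_part \<Lambda> (u n)" for n
  define g where "g n z = u n z - P n z" for n z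
  define h where "h n = disc_translate s (- a n) (g n)" for n
  have u: "u n holomorphic_on unit_disc" for n
    unfolding u_def by (intro holomorphic_on_disc_translate a_abs f)
  have u1: "bergman_norm 2 \<alpha> (u n) \<le> 1" for n
    unfolding u_def s_def by (intro bergman_norm_2_disc_translate_le_1 a f)
  have P: "P n holomorphic_on unit_disc" for n
    unfolding P_def by (rule holomorphic_on_taylor_part)
  have g: "g n holomorphic_on unit_disc" for n
    unfolding g_def by (intro holomorphic_intros u P)
  have h: "h n holomorphic_on unit_disc" for n
    unfolding h_def by (intro holomorphic_on_disc_translate a_abs g)
  have "bergman_norm 2 \<alpha> (g n) \<le> bergman_norm 2 \<alpha> (u n)" for n
    unfolding g_def P_def
    by (intro bergman_norm_2_mono circle_energy_taylor_part_le(2) [where R = 1] u \<Lambda>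
          holomorphic_on_imp_continuous_on holomorphic_intros) auto
  then have g1: "bergman_norm 2 \<alpha> (g n) \<le> 1" for n using u1 order_trans by blast
  have g0: "(deriv ^^ j) (g n) 0 = 0" if "j \<in> \<Lambda>" for j n
    unfolding g_def P_def by (rule deriv_minus_taylor_part [OF u _ \<Lambda> that]) simp
  have hB: "bergman_norm p \<beta> (h n) \<le> B" for n
  proof -
    have "bergman_norm p \<beta> (h n) = bergman_norm p \<beta> (g n)"
      unfolding h_def by (rule bergman_norm_disc_translate [OF a_abs(2) g \<beta>(2,1)])
    also have "\<dots> \<le> B" unfolding \<beta>_def s_def by (rule B [OF g g1]) (use g0 in blast)
    finally show ?thesis .
  qed
  have lim: "(\<lambda>n. h n z) \<longlonglongrightarrow> f z" if z: "z \<in> unit_disc" for z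
  proof -
    obtain K where K: "\<And>k f. f holomorphic_on unit_disc \<Longrightarrow> bergman_norm 2 \<alpha> f \<le> 1 \<Longrightarrow>
        cmod ((deriv ^^ k) f 0 / fact k) \<le> K k"
      using taylor_coefficient_bounded [OF \<alpha>] by metis
    have Pb: "cmod (P n w) \<le> (\<Sum>k\<in>\<Lambda>. K k)" if w: "cmod w < 1" for n w
      unfolding P_def taylor_part_def
    proof (rule sum_norm_le)
      fix k
      have "cmod ((deriv ^^ k) (u n) 0 / fact k * w ^ k) = cmod ((deriv ^^ k) (u n) 0 / fact k) * cmod w ^ k"
        by (simp only: norm_mult norm_power)
      also have "\<dots> \<le> cmod ((deriv ^^ k) (u n) 0 / fact k)"
        using w by (intro mult_left_le power_le_one) auto
      also have "\<dots> \<le> K k" by (rule K [OF u u1])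
      finally show "cmod ((deriv ^^ k) (u n) 0 / fact k * w ^ k) \<le> K k" .
    qed
    have h_eq: "h n z = f z - disc_translate s (- a n) (P n) z" for n
    proof -
      have "h n z = disc_translate s (- a n) (u n) z - disc_translate s (- a n) (P n) z"
        by (simp add: h_def g_def disc_translate_def left_diff_distrib)
      then show ?thesis
        unfolding u_def using disc_translate_inverse [OF a_abs(1) z] by simp
    qed
    \<comment> \<open>The back-translation factor tends to 0 away from its limiting pole -1, which lies on the boundary.\<close>
    have z1: "1 + z \<noteq> 0" using z by (auto simp: add_eq_0_iff)
    have "(\<lambda>n. disc_aut_factor (- a n) z) \<longlonglongrightarrow> of_real (sqrt (1 - 1\<^sup>2)) / (1 + of_real 1 * z)"
      unfolding disc_aut_factor_def using z1
      by (simp only: of_real_minus mult_minus_left diff_minus_eq_add power2_minus)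
         (intro tendsto_intros a1, simp)
    then have "(\<lambda>n. disc_aut_factor (- a n) z) \<longlonglongrightarrow> 0" by simp
    then have "(\<lambda>n. cmod (disc_aut_factor (- a n) z) powr s) \<longlonglongrightarrow> 0"
      using s by (intro tendsto_zero_powrI [of _ _ _ s] tendsto_norm_zero tendsto_const) auto
    then have null: "(\<lambda>n. (\<Sum>k\<in>\<Lambda>. K k) * cmod (disc_aut_factor (- a n) z) powr s) \<longlonglongrightarrow> 0"
      by (rule tendsto_mult_right_zero)
    have le: "cmod (disc_translate s (- a n) (P n) z)
        \<le> (\<Sum>k\<in>\<Lambda>. K k) * cmod (disc_aut_factor (- a n) z) powr s" for n
      unfolding cmod_disc_translate
      by (intro mult_right_mono Pb cmod_disc_aut_less_1 a_abs) (use z in auto)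
    have "(\<lambda>n. disc_translate s (- a n) (P n) z) \<longlonglongrightarrow> 0"
      by (rule Lim_null_comparison [OF always_eventually [OF allI [OF le]] null])
    then have "(\<lambda>n. f z - disc_translate s (- a n) (P n) z) \<longlonglongrightarrow> f z - 0"
      by (intro tendsto_intros)
    then show ?thesis by (simp add: h_eq)
  qed
  have "bergman_norm p \<beta> f \<le> B"
    by (rule bergman_norm_le_of_pointwise_limit [OF _ \<beta>(1) _ _ lim hB])
       (use p f h in \<open>auto intro: holomorphic_on_imp_continuous_on\<close>)
  then show ?thesis by (simp add: \<beta>_def s_def)
qed

theorem theorem2p1:
  fixes \<Lambda> :: "nat set" and \<alpha> p :: real
  assumes "finite \<Lambda>" and "\<alpha> \<ge> -1" and "p > 2"
  shows "Sup {bergman_norm p (p / 2 * (\<alpha> + 2) - 2) f | f.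
              f \<in> bergman_space 2 \<alpha> \<and> bergman_norm 2 \<alpha> f \<le> 1}
       = Sup {bergman_norm p (p / 2 * (\<alpha> + 2) - 2) f | f.
              f \<in> bergman_space 2 \<alpha> \<and> bergman_norm 2 \<alpha> f \<le> 1 \<and>
              (\<forall>j\<in>\<Lambda>. (deriv ^^ j) f 0 = 0)}"
    (is "Sup ?A = Sup ?B")
proof (rule antisym)
  show "Sup ?B \<le> Sup ?A" by (rule Sup_subset_mono) blast
  show "Sup ?A \<le> Sup ?B"
  proof (rule Sup_least)
    fix x assume "x \<in> ?A"
    then obtain f where x: "x = bergman_norm p (p / 2 * (\<alpha> + 2) - 2) f"
      and f: "f holomorphic_on unit_disc" "bergman_norm 2 \<alpha> f \<le> 1"
      by (auto simp: bergman_space_def)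
    have "bergman_norm p (p / 2 * (\<alpha> + 2) - 2) g \<le> Sup ?B"
      if g: "g holomorphic_on unit_disc" "bergman_norm 2 \<alpha> g \<le> 1" "\<forall>j\<in>\<Lambda>. (deriv ^^ j) g 0 = 0" for g
    proof (rule Sup_upper)
      have "bergman_norm 2 \<alpha> g < \<infinity>"
        using g(2) by (rule order_le_less_trans) simp
      then show "bergman_norm p (p / 2 * (\<alpha> + 2) - 2) g \<in> ?B"
        using g by (auto simp: bergman_space_def)
    qed
    then show "x \<le> Sup ?B"
      unfolding x by (rule bergman_norm_le_vanishing_bound [OF assms f])
  qed
qed

end
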